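(* Write $\mathbf{0}=(0,0)$ and $\mathbf{n}=(n,n)$. There is an absolute constant $C$ such that, for every integer $n\ge1$, every deterministic $t\ge0$, and every $u\ge2$, $$\mathbb{P}\left(\left|T_{\mathbf{0}}^{\mathbf{n},t}-T_{\mathbf{0}}^{\mathbf{n},0}\right|>C\left(\sqrt{ntu}+u\right)\right)\le2e^{-u}.$$
   Context: Brownian last passage percolation (BLPP). For points $p=(x_0,j_0)$, $q=(x_1,j_1)$ of $\mathbb{R}\times\mathbb{Z}$ write $p\le q$ if $x_0\le x_1$ and $j_0\le j_1$. A staircase $\xi$ from $p$ to $q$ is given by $x_0=\xi(j_0-1)\le\xi(j_0)\le\cdots\le\xi(j_1)=x_1$. Dynamics. For each $(i,j)\in\mathbb{Z}^2$ there is a process $X_{i,j}^t$, which at each time $t$ is a standard Brownian motion on $[0,1]$; the blocks evolve independently over $(i,j)$. Each block has an independent rate-one Poisson clock; whenever it rings, the entire path $X_{i,j}^t$ is replaced by a fresh independent standard Brownian motion on $[0,1]$, and between rings it is unchanged. This defines a stationary process, taken for $t\in\mathbb{R}$. Define $W_j^t:\mathbb{R}\to\mathbb{R}$ by $W_j^t(0)=0$ and $W_j^t(i+u)-W_j^t(i)=X_{i,j}^t(u)$ for $i,j\in\mathbb{Z}$, $u\in[0,1]$. The weight of a staircase at time $t$ is $\sum_{j=j_0}^{j_1}(W_j^t(\xi(j))-W_j^t(\xi(j-1)))$, and the passage time $T_p^{q,t}$ is the maximum weight over staircases from $p$ to $q$. *)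

theory Defs
  imports "HOL-Probability.Probability"
begin

definition independent_increments ::
    "'a measure \<Rightarrow> 'b measure \<Rightarrow> real set \<Rightarrow> (real \<Rightarrow> 'a \<Rightarrow> 'b::minus) \<Rightarrow> bool" where
  "independent_increments M S I Y \<longleftrightarrow>
     (\<forall>(k::nat) (s::nat \<Rightarrow> real). strict_mono_on {..k} s \<and> s ` {..k} \<subseteq> I \<longrightarrow>
        prob_space.indep_vars M (\<lambda>_. S) (\<lambda>i \<omega>. Y (s (Suc i)) \<omega> - Y (s i) \<omega>) {..<k})"

text \<open>Continuity is required for every outcome, so that the passage times below are attained
  maxima and are measurable.\<close>

definition brownian_motion_01 :: "'a measure \<Rightarrow> (real \<Rightarrow> 'a \<Rightarrow> real) \<Rightarrow> bool" where
  "brownian_motion_01 M Y \<longleftrightarrow>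
     (\<forall>u\<in>{0..1}. Y u \<in> borel_measurable M) \<and>
     (\<forall>\<omega>\<in>space M. Y 0 \<omega> = 0) \<and>
     (\<forall>\<omega>\<in>space M. continuous_on {0..1} (\<lambda>u. Y u \<omega>)) \<and>
     independent_increments M borel {0..1} Y \<and>
     (\<forall>u v. 0 \<le> u \<and> u < v \<and> v \<le> 1 \<longrightarrow>
        distributed M lborel (\<lambda>\<omega>. Y v \<omega> - Y u \<omega>) (normal_density 0 (sqrt (v - u))))"

text \<open>A rate-one Poisson clock on the whole time axis: for \<open>t \<ge> 0\<close> the value \<open>N t\<close> is the number of
  rings in \<open>(0, t]\<close>, and for \<open>t < 0\<close> it is minus the number of rings in \<open>(t, 0]\<close>.\<close>

definition poisson_clock :: "'a measure \<Rightarrow> (real \<Rightarrow> 'a \<Rightarrow> int) \<Rightarrow> bool" where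
  "poisson_clock M N \<longleftrightarrow>
     (\<forall>t. N t \<in> measurable M (count_space UNIV)) \<and>
     (\<forall>\<omega>\<in>space M. N 0 \<omega> = 0) \<and>
     (\<forall>\<omega>\<in>space M. mono (\<lambda>t. N t \<omega>)) \<and>
     (\<forall>\<omega>\<in>space M. \<forall>t. continuous (at_right t) (\<lambda>s. N s \<omega>)) \<and>
     independent_increments M (count_space UNIV) UNIV N \<and>
     (\<forall>s t. s < t \<longrightarrow>
        distr M (count_space UNIV) (\<lambda>\<omega>. nat (N t \<omega> - N s \<omega>)) = measure_pmf (poisson_pmf (t - s)))"

text \<open>The \<open>\<sigma>\<close>-algebra generated by the process \<open>(Y s)\<close>, \<open>s \<in> I\<close>.\<close>

definition process_events ::
    "'a measure \<Rightarrow> 'b measure \<Rightarrow> real set \<Rightarrow> (real \<Rightarrow> 'a \<Rightarrow> 'b) \<Rightarrow> 'a set set" where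
  "process_events M S I Y = sigma_sets (space M) {Y s -` A \<inter> space M | s A. s \<in> I \<and> A \<in> sets S}"

text \<open>The randomness driving the dynamics: \<open>N i j\<close> is the clock of block \<open>(i, j)\<close>, and \<open>B i j k\<close> is
  the fresh path installed at its \<open>k\<close>-th ring, where the last ring at or before time \<open>0\<close> has number
  \<open>0\<close>. All the clocks and all the paths are jointly independent.\<close>

locale dynamical_blpp = prob_space M for M :: "'a measure" +
  fixes N :: "int \<Rightarrow> int \<Rightarrow> real \<Rightarrow> 'a \<Rightarrow> int"
    and B :: "int \<Rightarrow> int \<Rightarrow> int \<Rightarrow> real \<Rightarrow> 'a \<Rightarrow> real"
  assumes clock: "\<And>i j. poisson_clock M (N i j)"
    and path: "\<And>i j k. brownian_motion_01 M (B i j k)"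
    and independent:
      "indep_sets
         (case_sum
           (\<lambda>(i, j). process_events M (count_space UNIV) UNIV (N i j))
           (\<lambda>(i, j, k). process_events M borel {0..1} (B i j k)))
         (UNIV :: (int \<times> int + int \<times> int \<times> int) set)"

definition block_path ::
    "(int \<Rightarrow> int \<Rightarrow> real \<Rightarrow> 'a \<Rightarrow> int) \<Rightarrow> (int \<Rightarrow> int \<Rightarrow> int \<Rightarrow> real \<Rightarrow> 'a \<Rightarrow> real) \<Rightarrow>
     real \<Rightarrow> 'a \<Rightarrow> int \<Rightarrow> int \<Rightarrow> real \<Rightarrow> real" where
  "block_path N B t \<omega> i j u = B i j (N i j t \<omega>) u \<omega>"

text \<open>The concatenation of the blocks of row \<open>j\<close>, normalised to vanish at \<open>0\<close>; at most one of the two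
  sums is nonempty.\<close>

definition row_path :: "(int \<Rightarrow> int \<Rightarrow> real \<Rightarrow> real) \<Rightarrow> int \<Rightarrow> real \<Rightarrow> real" where
  "row_path X j x =
     (\<Sum>i\<in>{0..<\<lfloor>x\<rfloor>}. X i j 1) - (\<Sum>i\<in>{\<lfloor>x\<rfloor>..<0}. X i j 1) + X \<lfloor>x\<rfloor> j (frac x)"

lemma row_path_0: "X 0 j 0 = 0 \<Longrightarrow> row_path X j 0 = 0"
  by (simp add: row_path_def)

lemma row_path_int:
  assumes "\<And>i. X i j 0 = 0"
  shows "row_path X j (of_int i) = (\<Sum>l\<in>{0..<i}. X l j 1) - (\<Sum>l\<in>{i..<0}. X l j 1)"
  using assms by (simp add: row_path_def)

lemma row_path_increment:
  assumes 0: "\<And>i. X i j 0 = 0" and u: "0 \<le> u" "u \<le> 1"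
  shows "row_path X j (of_int i + u) - row_path X j (of_int i) = X i j u"
proof (cases "u = 1")
  case False
  then have "\<lfloor>of_int i + u\<rfloor> = i" using u by (simp add: floor_eq_iff)
  then have "row_path X j (of_int i + u) =
      (\<Sum>l\<in>{0..<i}. X l j 1) - (\<Sum>l\<in>{i..<0}. X l j 1) + X i j u"
    by (simp add: row_path_def frac_def)
  then show ?thesis using row_path_int[of X j i] 0 by simp
next
  case True
  have *: "row_path X j (of_int i + u) = (\<Sum>l\<in>{0..<i+1}. X l j 1) - (\<Sum>l\<in>{i+1..<0}. X l j 1)"
    using row_path_int[of X j "i+1"] 0 True by simp
  show ?thesis
  proof (cases "0 \<le> i")
    case nonneg: True
    then have "{0..<i+1} = insert i {0..<i}" by auto
    then show ?thesis using * nonneg row_path_int[of X j i] 0 True by simp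
  next
    case neg: False
    then have "{i..<0} = insert i {i+1..<0}" by auto
    then show ?thesis using * neg row_path_int[of X j i] 0 True by simp
  qed
qed

text \<open>Only the values of a staircase on \<open>{j\<^sub>0 - 1..j\<^sub>1}\<close> are meaningful.\<close>

definition staircase :: "real \<times> int \<Rightarrow> real \<times> int \<Rightarrow> (int \<Rightarrow> real) \<Rightarrow> bool" where
  "staircase p q \<xi> \<longleftrightarrow>
     \<xi> (snd p - 1) = fst p \<and> \<xi> (snd q) = fst q \<and> (\<forall>j\<in>{snd p..snd q}. \<xi> (j - 1) \<le> \<xi> j)"

definition staircase_weight ::
    "(int \<Rightarrow> real \<Rightarrow> real) \<Rightarrow> real \<times> int \<Rightarrow> real \<times> int \<Rightarrow> (int \<Rightarrow> real) \<Rightarrow> real" where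
  "staircase_weight W p q \<xi> = (\<Sum>j\<in>{snd p..snd q}. W j (\<xi> j) - W j (\<xi> (j - 1)))"

text \<open>For \<open>p \<le> q\<close> and continuous rows the supremum is a maximum; for other \<open>p\<close>, \<open>q\<close> there are no
  staircases in general and the value is irrelevant.\<close>

definition passage_time :: "(int \<Rightarrow> real \<Rightarrow> real) \<Rightarrow> real \<times> int \<Rightarrow> real \<times> int \<Rightarrow> real" where
  "passage_time W p q = (SUP \<xi>\<in>{\<xi>. staircase p q \<xi>}. staircase_weight W p q \<xi>)"

definition dynamical_passage_time ::
    "(int \<Rightarrow> int \<Rightarrow> real \<Rightarrow> 'a \<Rightarrow> int) \<Rightarrow> (int \<Rightarrow> int \<Rightarrow> int \<Rightarrow> real \<Rightarrow> 'a \<Rightarrow> real) \<Rightarrow>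
     real \<times> int \<Rightarrow> real \<times> int \<Rightarrow> real \<Rightarrow> 'a \<Rightarrow> real" where
  "dynamical_passage_time N B p q t \<omega> = passage_time (row_path (block_path N B t \<omega>)) p q"

end

theory Submission
  imports Defs
begin

text \<open>Cut the rows into cells of width \<open>1/m\<close>. A staircase with corners on the grid is then a set of
  cells, its weight is the sum of the increments over these cells, and the passage time is the limit,
  as \<open>m \<rightarrow> \<infinity>\<close>, of the maximum \<open>f(x)\<close> of finitely many such sums. The increments \<open>x\<close> at time
  \<open>0\<close> are independent Gaussian variables of variance \<open>1/m\<close>, and given the clocks, time \<open>t\<close> replaces
  the coordinates in the set \<open>R\<close> of cells whose block has rung by independent copies \<open>x'\<close>.

  The crude bound by the largest possible overlap of a staircase with \<open>R\<close> is too weak, since a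
  staircase can seek out the blocks that have rung; only the overlap of the maximiser with \<open>R\<close> is of
  the right order. The Maurey--Pisier rotation gives exactly this. Let
  \<open>x\<^sub>\<theta> = cos \<theta> x + sin \<theta> x'\<close> on \<open>R\<close>. Rotation invariance makes \<open>(x\<^sub>\<theta>, x\<^sub>\<theta>\<^sub>+\<^sub>\<delta>)\<close> equal in law to
  \<open>(x, x\<^sub>\<delta>)\<close>, and if \<open>\<xi>\<close> maximises for \<open>x\<close> then
  \<open>f(x) - f(x\<^sub>\<delta>) \<le> \<Sum>\<^bsub>\<xi> \<inter> R\<^esub> ((1 - cos \<delta>) x - sin \<delta> x')\<close>, where \<open>x'\<close> is independent of \<open>x\<close> and so
  can be integrated out. Going from \<open>\<theta> = 0\<close> to \<open>\<pi>/2\<close> in \<open>K\<close> equal steps, applying Jensen's inequality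
  and letting \<open>K \<rightarrow> \<infinity>\<close> yields
  \<open>E exp (\<plusminus>\<lambda> (f(x\<^bsub>\<pi>/2\<^esub>) - f(x))) \<le> E exp (2 \<lambda>\<^sup>2 |\<xi>(x) \<inter> R| / m)\<close>
  (\<open>max_sum_resample\<close>; the term with \<open>1 - cos \<delta>\<close> disappears in the limit).

  The maximiser \<open>\<xi>(x)\<close> depends on the configuration at time \<open>0\<close> only and is therefore independent of
  the clocks. Its total length is \<open>n\<close>, it spends at most length \<open>1\<close> in any block, and each block has
  rung with probability at most \<open>t\<close>. Averaging the right-hand side over the clocks thus gives
  \<open>exp (4 \<lambda>\<^sup>2 n t)\<close> when \<open>2 \<lambda>\<^sup>2 \<le> 1\<close> (\<open>exp_max_sum_resample_clocks\<close>). The bound does not depend on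
  \<open>m\<close>, so Fatou's lemma transfers it to the passage times (\<open>exp_passage_time_difference\<close>), and
  Markov's inequality with \<open>\<lambda> = sqrt (u / (n t)) / 2\<close> if \<open>u \<le> n t\<close>, and \<open>\<lambda> = 1/2\<close> otherwise, finishes
  the proof with \<open>C = 4\<close>.\<close>

section \<open>Rotation invariance of product Gaussian measures\<close>

abbreviation gauss :: "real \<Rightarrow> real measure" where
  "gauss \<sigma> \<equiv> density lborel (\<lambda>x. ennreal (normal_density 0 \<sigma> x))"

text \<open>Two affine substitutions, one in each variable; this is where \<open>c \<noteq> 0\<close> enters, so the quarter
  turn itself is obtained later from two eighth turns.\<close>

lemma nn_integral_lborel_rotation:
  fixes F :: "real \<times> real \<Rightarrow> ennreal" and c s :: real
  assumes [measurable]: "F \<in> borel_measurable (borel \<Otimes>\<^sub>M borel)"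
    and c: "c > 0" and cs: "c\<^sup>2 + s\<^sup>2 = 1"
  shows "(\<integral>\<^sup>+x. \<integral>\<^sup>+y. F (c * x + s * y, c * y - s * x) \<partial>lborel \<partial>lborel) =
    (\<integral>\<^sup>+x. \<integral>\<^sup>+y. F (x, y) \<partial>lborel \<partial>lborel)"
proof -
  have eq: "c * (- (s * y) / c + 1 / c * u) + s * y = u"
    "c * y - s * (- (s * y) / c + 1 / c * u) = (y - s * u) / c" for u y
  proof -
    show "c * (- (s * y) / c + 1 / c * u) + s * y = u"
      using c by (simp add: field_simps)
    have "c * y - s * (- (s * y) / c + 1 / c * u) = ((c\<^sup>2 + s\<^sup>2) * y - s * u) / c"
      using c by (simp add: field_simps power2_eq_square)
    then show "c * y - s * (- (s * y) / c + 1 / c * u) = (y - s * u) / c"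
      using cs by simp
  qed
  have "(\<integral>\<^sup>+x. \<integral>\<^sup>+y. F (c * x + s * y, c * y - s * x) \<partial>lborel \<partial>lborel) =
      (\<integral>\<^sup>+y. \<integral>\<^sup>+x. F (c * x + s * y, c * y - s * x) \<partial>lborel \<partial>lborel)"
    by (rule lborel_pair.Fubini') simp
  also have "\<dots> = (\<integral>\<^sup>+y. ennreal (1 / c) * (\<integral>\<^sup>+u. F (u, (y - s * u) / c) \<partial>lborel) \<partial>lborel)"
  proof (rule nn_integral_cong)
    fix y
    show "(\<integral>\<^sup>+x. F (c * x + s * y, c * y - s * x) \<partial>lborel) =
        ennreal (1 / c) * (\<integral>\<^sup>+u. F (u, (y - s * u) / c) \<partial>lborel)"
      using c nn_integral_real_affine[of "\<lambda>x. F (c * x + s * y, c * y - s * x)" "1 / c" "- (s * y) / c"]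
      by (simp only: eq) simp
  qed
  also have "\<dots> = ennreal (1 / c) * (\<integral>\<^sup>+y. \<integral>\<^sup>+u. F (u, (y - s * u) / c) \<partial>lborel \<partial>lborel)"
    by (rule nn_integral_cmult) simp
  also have "(\<integral>\<^sup>+y. \<integral>\<^sup>+u. F (u, (y - s * u) / c) \<partial>lborel \<partial>lborel) =
      (\<integral>\<^sup>+u. \<integral>\<^sup>+y. F (u, (y - s * u) / c) \<partial>lborel \<partial>lborel)"
    by (rule lborel_pair.Fubini') simp
  also have "\<dots> = (\<integral>\<^sup>+u. ennreal c * (\<integral>\<^sup>+w. F (u, w) \<partial>lborel) \<partial>lborel)"
  proof (rule nn_integral_cong)
    fix u
    show "(\<integral>\<^sup>+y. F (u, (y - s * u) / c) \<partial>lborel) = ennreal c * (\<integral>\<^sup>+w. F (u, w) \<partial>lborel)"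
      using c nn_integral_real_affine[of "\<lambda>y. F (u, (y - s * u) / c)" c "s * u"] by simp
  qed
  also have "\<dots> = ennreal c * (\<integral>\<^sup>+u. \<integral>\<^sup>+w. F (u, w) \<partial>lborel \<partial>lborel)"
    by (rule nn_integral_cmult) simp
  finally show ?thesis
    using c by (simp flip: mult.assoc ennreal_mult')
qed

lemma gauss_rotation_acute:
  fixes H :: "real \<times> real \<Rightarrow> ennreal" and c s \<sigma> :: real
  assumes [measurable]: "H \<in> borel_measurable (borel \<Otimes>\<^sub>M borel)"
    and c: "c > 0" and cs: "c\<^sup>2 + s\<^sup>2 = 1"
  shows "(\<integral>\<^sup>+x. \<integral>\<^sup>+y. H (c * x + s * y, c * y - s * x) \<partial>gauss \<sigma> \<partial>gauss \<sigma>) =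
    (\<integral>\<^sup>+x. \<integral>\<^sup>+y. H (x, y) \<partial>gauss \<sigma> \<partial>gauss \<sigma>)"
proof -
  define D where "D x = ennreal (normal_density 0 \<sigma> x)" for x
  have [measurable]: "D \<in> borel_measurable borel" unfolding D_def by simp
  define F where "F = (\<lambda>(x, y). D x * (D y * H (x, y)))"
  have [measurable]: "F \<in> borel_measurable (borel \<Otimes>\<^sub>M borel)" unfolding F_def by simp
  have *: "(\<integral>\<^sup>+x. \<integral>\<^sup>+y. g x y \<partial>gauss \<sigma> \<partial>gauss \<sigma>) = (\<integral>\<^sup>+x. \<integral>\<^sup>+y. D x * (D y * g x y) \<partial>lborel \<partial>lborel)"
    if [measurable]: "case_prod g \<in> borel_measurable (borel \<Otimes>\<^sub>M borel)" for g
  proof -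
    have [measurable]: "g x \<in> borel_measurable borel" for x
      using measurable_compose[OF measurable_Pair1'[of x borel borel] that] by simp
    have "(\<integral>\<^sup>+x. \<integral>\<^sup>+y. g x y \<partial>gauss \<sigma> \<partial>gauss \<sigma>) = (\<integral>\<^sup>+x. \<integral>\<^sup>+y. D y * g x y \<partial>lborel \<partial>gauss \<sigma>)"
      by (intro nn_integral_cong) (simp add: nn_integral_density D_def)
    also have "\<dots> = (\<integral>\<^sup>+x. D x * (\<integral>\<^sup>+y. D y * g x y \<partial>lborel) \<partial>lborel)"
      by (subst nn_integral_density) (simp_all add: D_def)
    also have "\<dots> = (\<integral>\<^sup>+x. \<integral>\<^sup>+y. D x * (D y * g x y) \<partial>lborel \<partial>lborel)"
      by (simp add: nn_integral_cmult)
    finally show ?thesis .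
  qed
  have sq: "(c * x + s * y)\<^sup>2 + (c * y - s * x)\<^sup>2 = x\<^sup>2 + y\<^sup>2" for x y
  proof -
    have "(c * x + s * y)\<^sup>2 + (c * y - s * x)\<^sup>2 = (c\<^sup>2 + s\<^sup>2) * (x\<^sup>2 + y\<^sup>2)"
      by (simp add: power2_eq_square algebra_simps)
    then show ?thesis using cs by simp
  qed
  have D2: "D x * D y = D (c * x + s * y) * D (c * y - s * x)" for x y
  proof -
    have nd: "normal_density 0 \<sigma> x * normal_density 0 \<sigma> y =
        1 / (2 * pi * \<sigma>\<^sup>2) * exp (- (x\<^sup>2 + y\<^sup>2) / (2 * \<sigma>\<^sup>2))" for x y
      by (simp add: normal_density_def exp_add[symmetric] add_divide_distrib diff_divide_distrib)
    show ?thesis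
      unfolding D_def ennreal_mult'[OF normal_density_nonneg, symmetric] nd sq ..
  qed
  have "(\<integral>\<^sup>+x. \<integral>\<^sup>+y. H (c * x + s * y, c * y - s * x) \<partial>gauss \<sigma> \<partial>gauss \<sigma>) =
     (\<integral>\<^sup>+x. \<integral>\<^sup>+y. F (c * x + s * y, c * y - s * x) \<partial>lborel \<partial>lborel)"
    unfolding F_def prod.case mult.assoc[symmetric] D2[symmetric]
    by (subst *) (simp_all add: mult.assoc)
  also have "\<dots> = (\<integral>\<^sup>+x. \<integral>\<^sup>+y. F (x, y) \<partial>lborel \<partial>lborel)"
    by (rule nn_integral_lborel_rotation) (use c cs in auto)
  also have "\<dots> = (\<integral>\<^sup>+x. \<integral>\<^sup>+y. H (x, y) \<partial>gauss \<sigma> \<partial>gauss \<sigma>)"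
    unfolding F_def prod.case by (subst *) simp_all
  finally show ?thesis .
qed

text \<open>Completing the square turns the tilted density into a shifted one.\<close>

lemma gauss_mgf:
  assumes "\<sigma> > 0"
  shows "(\<integral>\<^sup>+x. ennreal (exp (a * x)) \<partial>gauss \<sigma>) = ennreal (exp (a\<^sup>2 * \<sigma>\<^sup>2 / 2))"
proof -
  have sq: "a * x - x\<^sup>2 / (2 * \<sigma>\<^sup>2) = a\<^sup>2 * \<sigma>\<^sup>2 / 2 - (x - a * \<sigma>\<^sup>2)\<^sup>2 / (2 * \<sigma>\<^sup>2)" for x
    using assms by (simp add: field_simps power2_eq_square)
  have nd: "normal_density 0 \<sigma> x * exp (a * x) = exp (a\<^sup>2 * \<sigma>\<^sup>2 / 2) * normal_density (a * \<sigma>\<^sup>2) \<sigma> x" for x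
    using sq[of x] by (simp add: normal_density_def flip: exp_add)
  have "(\<integral>\<^sup>+x. ennreal (exp (a * x)) \<partial>gauss \<sigma>) =
      (\<integral>\<^sup>+x. ennreal (exp (a\<^sup>2 * \<sigma>\<^sup>2 / 2)) * ennreal (normal_density (a * \<sigma>\<^sup>2) \<sigma> x) \<partial>lborel)"
    by (simp add: nn_integral_density nd flip: ennreal_mult')
  also have "\<dots> = ennreal (exp (a\<^sup>2 * \<sigma>\<^sup>2 / 2)) * (\<integral>\<^sup>+x. ennreal (normal_density (a * \<sigma>\<^sup>2) \<sigma> x) \<partial>lborel)"
    by (simp add: nn_integral_cmult)
  also have "(\<integral>\<^sup>+x. ennreal (normal_density (a * \<sigma>\<^sup>2) \<sigma> x) \<partial>lborel) = 1"
    using prob_space.emeasure_space_1[OF prob_space_normal_density[OF assms, of "a * \<sigma>\<^sup>2"]]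
    by (simp add: emeasure_density)
  finally show ?thesis by simp
qed

text \<open>The coordinates \<open>(e, False)\<close> hold a configuration and the coordinates \<open>(e, True)\<close> an
  independent copy of it. The map rotates each such pair with \<open>e \<in> R\<close> by the angle \<open>\<theta>\<close>: the rotation
  by \<open>\<pi>/2\<close> brings the copy into the first coordinate, so it interpolates between the configuration and
  its resampling on \<open>R\<close>.\<close>

definition rot :: "'e set \<Rightarrow> real \<Rightarrow> ('e \<times> bool \<Rightarrow> real) \<Rightarrow> 'e \<times> bool \<Rightarrow> real" where
  "rot R \<theta> z = (\<lambda>(e, b). if e \<in> R then
      (if b then cos \<theta> * z (e, True) - sin \<theta> * z (e, False)
       else cos \<theta> * z (e, False) + sin \<theta> * z (e, True))
     else z (e, b))"

lemma rot_add: "rot R \<alpha> (rot R \<beta> z) = rot R (\<alpha> + \<beta>) z"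
  by (auto simp: rot_def fun_eq_iff cos_add sin_add algebra_simps)

lemma rot_insert: "e \<notin> R \<Longrightarrow> rot (insert e R) \<theta> z = rot {e} \<theta> (rot R \<theta> z)"
  by (auto simp: rot_def fun_eq_iff)

lemma rot_empty [simp]: "rot {} \<theta> z = z"
  by (auto simp: rot_def fun_eq_iff)

abbreviation gauss_pairs :: "real \<Rightarrow> 'e set \<Rightarrow> ('e \<times> bool \<Rightarrow> real) measure" where
  "gauss_pairs \<sigma> E \<equiv> Pi\<^sub>M (E \<times> UNIV) (\<lambda>_. gauss \<sigma>)"

lemma rot_measurable:
  assumes "R \<subseteq> E"
  shows "rot R \<theta> \<in> measurable (gauss_pairs \<sigma> E) (gauss_pairs \<sigma> E)"
proof (rule measurable_PiM_single')
  show "(\<lambda>z. rot R \<theta> z p) \<in> measurable (gauss_pairs \<sigma> E) (gauss \<sigma>)" if "p \<in> E \<times> UNIV" for p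
    using assms that by (cases p) (auto simp: rot_def)
  show "rot R \<theta> \<in> space (gauss_pairs \<sigma> E) \<rightarrow> (\<Pi>\<^sub>E i\<in>E \<times> UNIV. space (gauss \<sigma>))"
    using assms by (auto simp: rot_def space_PiM PiE_iff extensional_def split: if_splits) blast+
qed

text \<open>Integrating out the pair of coordinates that is rotated, with all the others held fixed, leaves a
  rotation of the plane.\<close>

lemma gauss_pairs_rot_single_acute:
  assumes E: "finite E" "e \<in> E" and \<theta>: "cos \<theta> > 0" and \<sigma>: "\<sigma> > 0"
    and H[measurable]: "H \<in> borel_measurable (gauss_pairs \<sigma> E)"
  shows "(\<integral>\<^sup>+z. H (rot {e} \<theta> z) \<partial>gauss_pairs \<sigma> E) = (\<integral>\<^sup>+z. H z \<partial>gauss_pairs \<sigma> E)"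
proof -
  interpret N: prob_space "gauss \<sigma>" using prob_space_normal_density[OF \<sigma>] .
  interpret product_sigma_finite "\<lambda>_. gauss \<sigma>" ..
  define J where "J = (E - {e}) \<times> (UNIV :: bool set)"
  have J: "finite J" "(e, False) \<notin> J" "(e, True) \<notin> insert (e, False) J" "finite (insert (e, False) J)"
    "E \<times> UNIV = insert (e, True) (insert (e, False) J)"
    using E unfolding J_def by (auto simp: UNIV_bool)
  have *: "(\<integral>\<^sup>+z. G z \<partial>gauss_pairs \<sigma> E) =
     (\<integral>\<^sup>+w. \<integral>\<^sup>+x. \<integral>\<^sup>+y. G (w((e, False) := x, (e, True) := y)) \<partial>gauss \<sigma> \<partial>gauss \<sigma> \<partial>Pi\<^sub>M J (\<lambda>_. gauss \<sigma>))"
    if G: "G \<in> borel_measurable (gauss_pairs \<sigma> E)" for G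
  proof -
    note [measurable] = G[unfolded J(5)]
    have [measurable]: "(\<lambda>p. G ((fst p)((e, True) := snd p)))
        \<in> borel_measurable (Pi\<^sub>M (insert (e, False) J) (\<lambda>_. gauss \<sigma>) \<Otimes>\<^sub>M gauss \<sigma>)"
      using measurable_compose[OF measurable_add_dim G[unfolded J(5)]] by (simp add: split_beta)
    have "(\<lambda>w. \<integral>\<^sup>+y. G (w((e, True) := y)) \<partial>gauss \<sigma>)
        \<in> borel_measurable (Pi\<^sub>M (insert (e, False) J) (\<lambda>_. gauss \<sigma>))"
      by (rule N.borel_measurable_nn_integral) (simp add: split_beta)
    then show ?thesis
      unfolding J(5) by (simp only: product_nn_integral_insert[OF J(4,3) G[unfolded J(5)]]
        product_nn_integral_insert[OF J(1,2)])
  qed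
  have HR: "(\<lambda>z. H (rot {e} \<theta> z)) \<in> borel_measurable (gauss_pairs \<sigma> E)"
    by (rule measurable_compose[OF rot_measurable H]) (use E in auto)
  show ?thesis
    unfolding *[OF H] *[OF HR]
  proof (rule nn_integral_cong)
    fix w assume w: "w \<in> space (Pi\<^sub>M J (\<lambda>_. gauss \<sigma>))"
    define F where "F = (\<lambda>(x, y). H (w((e, False) := x, (e, True) := y)))"
    have "(\<lambda>p. w((e, False) := fst p, (e, True) := snd p)) \<in> measurable (borel \<Otimes>\<^sub>M borel) (gauss_pairs \<sigma> E)"
    proof (rule measurable_PiM_single')
      show "(\<lambda>p. (w((e, False) := fst p, (e, True) := snd p)) q) \<in> measurable (borel \<Otimes>\<^sub>M borel) (gauss \<sigma>)" for q
        by (auto simp: fun_upd_def)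
      show "(\<lambda>p. w((e, False) := fst p, (e, True) := snd p)) \<in> space (borel \<Otimes>\<^sub>M borel) \<rightarrow> (\<Pi>\<^sub>E i\<in>E \<times> UNIV. space (gauss \<sigma>))"
        using w unfolding J(5) by (auto simp: space_PiM PiE_iff extensional_def)
    qed
    from measurable_compose[OF this H] have F: "F \<in> borel_measurable (borel \<Otimes>\<^sub>M borel)"
      by (simp add: F_def split_beta)
    have rot: "rot {e} \<theta> (w((e, False) := x, (e, True) := y)) =
      w((e, False) := cos \<theta> * x + sin \<theta> * y, (e, True) := cos \<theta> * y - sin \<theta> * x)" for x y
      by (auto simp: rot_def fun_eq_iff)
    show "(\<integral>\<^sup>+x. \<integral>\<^sup>+y. H (rot {e} \<theta> (w((e, False) := x, (e, True) := y))) \<partial>gauss \<sigma> \<partial>gauss \<sigma>) =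
       (\<integral>\<^sup>+x. \<integral>\<^sup>+y. H (w((e, False) := x, (e, True) := y)) \<partial>gauss \<sigma> \<partial>gauss \<sigma>)"
      using gauss_rotation_acute[OF F \<theta>, of "sin \<theta>" \<sigma>] by (simp add: F_def rot)
  qed
qed

text \<open>The pairs in \<open>R\<close> are rotated one after the other, each of them twice by \<open>\<theta>/2\<close>, as
  \<open>cos (\<theta>/2) > 0\<close> even at \<open>\<theta> = \<pi>/2\<close>.\<close>

lemma gauss_pairs_rot:
  assumes E: "finite E" "R \<subseteq> E" and \<theta>: "0 \<le> \<theta>" "\<theta> \<le> pi / 2" and \<sigma>: "\<sigma> > 0"
    and H: "H \<in> borel_measurable (gauss_pairs \<sigma> E)"
  shows "(\<integral>\<^sup>+z. H (rot R \<theta> z) \<partial>gauss_pairs \<sigma> E) = (\<integral>\<^sup>+z. H z \<partial>gauss_pairs \<sigma> E)"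
proof -
  have acute: "(\<integral>\<^sup>+z. G (rot R (\<theta> / 2) z) \<partial>gauss_pairs \<sigma> E) = (\<integral>\<^sup>+z. G z \<partial>gauss_pairs \<sigma> E)"
    if "G \<in> borel_measurable (gauss_pairs \<sigma> E)" for G
    using finite_subset[OF E(2,1)] E(2) that
  proof (induction R arbitrary: G rule: finite_induct)
    case (insert e R)
    have "cos (\<theta> / 2) > 0" using \<theta> pi_gt_zero by (intro cos_gt_zero_pi) linarith+
    have "(\<integral>\<^sup>+z. G (rot (insert e R) (\<theta> / 2) z) \<partial>gauss_pairs \<sigma> E) =
       (\<integral>\<^sup>+z. G (rot {e} (\<theta> / 2) (rot R (\<theta> / 2) z)) \<partial>gauss_pairs \<sigma> E)"
      by (simp add: rot_insert[OF insert.hyps(2)])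
    also have "\<dots> = (\<integral>\<^sup>+z. G (rot {e} (\<theta> / 2) z) \<partial>gauss_pairs \<sigma> E)"
      using insert.prems
      by (intro insert.IH measurable_compose[OF rot_measurable insert.prems(2)]) auto
    also have "\<dots> = (\<integral>\<^sup>+z. G z \<partial>gauss_pairs \<sigma> E)"
      using insert.prems \<open>cos (\<theta> / 2) > 0\<close> by (intro gauss_pairs_rot_single_acute E \<sigma>) auto
    finally show ?case .
  qed simp
  have "(\<integral>\<^sup>+z. H (rot R \<theta> z) \<partial>gauss_pairs \<sigma> E) =
      (\<integral>\<^sup>+z. H (rot R (\<theta> / 2) (rot R (\<theta> / 2) z)) \<partial>gauss_pairs \<sigma> E)"
    by (simp add: rot_add)
  also have "\<dots> = (\<integral>\<^sup>+z. H z \<partial>gauss_pairs \<sigma> E)"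
    using acute[OF measurable_compose[OF rot_measurable[OF E(2)] H]] acute[OF H] by simp
  finally show ?thesis .
qed

section \<open>Maxima of sums of Gaussian variables, partly resampled\<close>

definition max_sum :: "'e set set \<Rightarrow> ('e \<Rightarrow> real) \<Rightarrow> real" where
  "max_sum S x = Max ((\<lambda>A. \<Sum>e\<in>A. x e) ` S)"

text \<open>Ties are broken by an enumeration of the family, which makes the choice a measurable function of
  the configuration.\<close>

definition argmax_sum :: "'e set set \<Rightarrow> ('e \<Rightarrow> real) \<Rightarrow> 'e set" where
  "argmax_sum S x = from_nat_into S (LEAST k. (\<Sum>e\<in>from_nat_into S k. x e) = max_sum S x)"

lemma sum_le_max_sum: "finite S \<Longrightarrow> A \<in> S \<Longrightarrow> (\<Sum>e\<in>A. x e) \<le> max_sum S x"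
  by (simp add: max_sum_def)

lemma argmax_sum:
  assumes "finite S" "S \<noteq> {}"
  shows "argmax_sum S x \<in> S" "(\<Sum>e\<in>argmax_sum S x. x e) = max_sum S x"
proof -
  show "argmax_sum S x \<in> S"
    using assms by (simp add: argmax_sum_def from_nat_into)
  have "max_sum S x \<in> (\<lambda>A. \<Sum>e\<in>A. x e) ` S"
    using assms by (auto simp: max_sum_def)
  then obtain A where "A \<in> S" "(\<Sum>e\<in>A. x e) = max_sum S x" by auto
  then have "\<exists>k. (\<Sum>e\<in>from_nat_into S k. x e) = max_sum S x"
    using from_nat_into_surj[of S A] assms by (auto simp: countable_finite)
  then show "(\<Sum>e\<in>argmax_sum S x. x e) = max_sum S x"
    unfolding argmax_sum_def by (rule LeastI_ex)
qed

lemma max_sum_cong: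
  assumes "\<And>A. A \<in> S \<Longrightarrow> A \<subseteq> E" "\<And>e. e \<in> E \<Longrightarrow> x e = y e"
  shows "max_sum S x = max_sum S y"
proof -
  have "(\<lambda>A. \<Sum>e\<in>A. x e) ` S = (\<lambda>A. \<Sum>e\<in>A. y e) ` S"
    using assms by (intro image_cong sum.cong) auto
  then show ?thesis by (simp add: max_sum_def)
qed

lemma max_sum_measurable:
  assumes "finite S" "S \<noteq> {}" "\<And>A. A \<in> S \<Longrightarrow> A \<subseteq> E" "\<And>e. e \<in> E \<Longrightarrow> (\<lambda>\<omega>. X \<omega> e) \<in> borel_measurable M"
  shows "(\<lambda>\<omega>. max_sum S (X \<omega>)) \<in> borel_measurable M"
  unfolding max_sum_def
  using assms by (intro borel_measurable_Max borel_measurable_sum) auto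

lemma argmax_sum_measurable:
  assumes S: "finite S" "S \<noteq> {}" "\<And>A. A \<in> S \<Longrightarrow> A \<subseteq> E"
    and X: "\<And>e. e \<in> E \<Longrightarrow> (\<lambda>\<omega>. X \<omega> e) \<in> borel_measurable M"
  shows "(\<lambda>\<omega>. argmax_sum S (X \<omega>)) \<in> measurable M (count_space UNIV)"
proof -
  have [measurable]: "(\<lambda>\<omega>. max_sum S (X \<omega>)) \<in> borel_measurable M"
    using assms by (rule max_sum_measurable)
  have [measurable]: "(\<lambda>\<omega>. \<Sum>e\<in>from_nat_into S k. X \<omega> e) \<in> borel_measurable M" for k
    using S X from_nat_into[OF S(2), of k] by (intro borel_measurable_sum) auto
  have "(\<lambda>\<omega>. LEAST k. (\<Sum>e\<in>from_nat_into S k. X \<omega> e) = max_sum S (X \<omega>)) \<in> measurable M (count_space UNIV)"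
    by measurable
  then show ?thesis
    unfolding argmax_sum_def by (rule measurable_compose) simp
qed

text \<open>Jensen's inequality for the average of the \<open>K\<close> rescaled increments.\<close>

lemma exp_telescope_le:
  fixes a :: "nat \<Rightarrow> real"
  assumes K: "K > 0"
  shows "exp (l * (a 0 - a K)) \<le> (\<Sum>k<K. exp (l * K * (a k - a (Suc k))) / K)"
proof -
  have "exp (\<Sum>k<K. (1 / K) *\<^sub>R (l * K * (a k - a (Suc k)))) \<le>
      (\<Sum>k<K. (1 / K) * exp (l * K * (a k - a (Suc k))))"
    using K convex_on_exp[of 1] by (intro convex_on_sum) auto
  moreover have "(\<Sum>k<K. (1 / K) *\<^sub>R (l * K * (a k - a (Suc k)))) = l * (a 0 - a K)"
    using K sum_lessThan_telescope'[of a K] by (simp flip: sum_distrib_left)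
  ultimately show ?thesis by simp
qed

lemma one_minus_cos_le: "1 - cos x \<le> x\<^sup>2 / 2" for x :: real
proof -
  have "(sin (x / 2))\<^sup>2 \<le> (x / 2)\<^sup>2"
    using abs_sin_x_le_abs_x by (rule abs_le_square_iff[THEN iffD1])
  then show ?thesis
    using cos_double_sin[of "x / 2"] by (simp add: power_divide)
qed

context
  fixes \<sigma> :: real and E :: "'e set"
  assumes \<sigma>: "\<sigma> > 0" and E: "finite E"
begin

interpretation N: prob_space "gauss \<sigma>"
  using prob_space_normal_density[OF \<sigma>] .

interpretation product_prob_space "\<lambda>_. gauss \<sigma>" ..

lemma gauss_pairs_fold:
  assumes H: "H \<in> borel_measurable (gauss_pairs \<sigma> E)"
  shows "(\<integral>\<^sup>+z. H z \<partial>gauss_pairs \<sigma> E) =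
    (\<integral>\<^sup>+x. \<integral>\<^sup>+y. H (merge (E \<times> {False}) (E \<times> {True}) (x, y))
       \<partial>Pi\<^sub>M (E \<times> {True}) (\<lambda>_. gauss \<sigma>) \<partial>Pi\<^sub>M (E \<times> {False}) (\<lambda>_. gauss \<sigma>))"
proof -
  have *: "E \<times> UNIV = E \<times> {False} \<union> E \<times> {True}" by (auto simp: UNIV_bool)
  show ?thesis
    unfolding * by (rule product_nn_integral_fold) (use E H in \<open>auto simp: *\<close>)
qed

lemma coordinate_measurable: "e \<in> E \<Longrightarrow> (\<lambda>z. z (e, b)) \<in> borel_measurable (gauss_pairs \<sigma> E)"
  using measurable_component_singleton[of "(e, b)" "E \<times> UNIV" "\<lambda>_. gauss \<sigma>"] by simp

text \<open>The set \<open>\<xi>\<close> that is optimal for \<open>z\<close> competes in the maximum for the rotated configuration, so the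
  difference of the two maxima is at most the difference of the two sums over \<open>\<xi>\<close>. Since \<open>\<xi>\<close> does not
  depend on the copy, the copy contributes a Gaussian variable of variance
  \<open>(sin \<delta>)\<^sup>2 \<sigma>\<^sup>2 |\<xi> \<inter> R|\<close>, whose exponential moment is explicit.\<close>

lemma max_sum_rotation_step:
  assumes R: "R \<subseteq> E" and S: "finite S" "S \<noteq> {}" "\<And>A. A \<in> S \<Longrightarrow> A \<subseteq> E" and \<mu>: "\<mu> \<ge> 0"
  shows "(\<integral>\<^sup>+z. ennreal (exp (\<mu> * (max_sum S (\<lambda>e. z (e, False)) - max_sum S (\<lambda>e. rot R \<delta> z (e, False))))) \<partial>gauss_pairs \<sigma> E)
    \<le> (\<integral>\<^sup>+z. ennreal (exp (\<mu> * (1 - cos \<delta>) * (\<Sum>e\<in>E. \<bar>z (e, False)\<bar>) +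
         (\<mu> * sin \<delta>)\<^sup>2 * \<sigma>\<^sup>2 / 2 * card (argmax_sum S (\<lambda>e. z (e, False)) \<inter> R))) \<partial>gauss_pairs \<sigma> E)"
    (is "_ \<le> (\<integral>\<^sup>+z. ?B z \<partial>_)")
proof -
  let ?\<xi> = "\<lambda>z. argmax_sum S (\<lambda>e. z (e, False))"
  let ?U = "\<lambda>z. \<mu> * (1 - cos \<delta>) * (\<Sum>e\<in>E. \<bar>z (e, False)\<bar>)"
  let ?G = "\<lambda>z. ennreal (exp (?U z)) * (\<Prod>p\<in>E \<times> {True}. ennreal (exp ((if fst p \<in> ?\<xi> z \<inter> R then - (\<mu> * sin \<delta>) else 0) * z p)))"
  have \<xi>: "?\<xi> \<in> measurable (gauss_pairs \<sigma> E) (count_space UNIV)"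
    by (rule argmax_sum_measurable[OF S]) (auto intro: coordinate_measurable)
  have [measurable]: "(\<lambda>z. real (card (?\<xi> z \<inter> R))) \<in> borel_measurable (gauss_pairs \<sigma> E)"
    by (rule measurable_compose[OF \<xi>]) simp
  have U[measurable]: "?U \<in> borel_measurable (gauss_pairs \<sigma> E)"
    by (intro borel_measurable_times borel_measurable_const borel_measurable_sum borel_measurable_abs
        coordinate_measurable)
  have "(\<lambda>z. ennreal (exp ((if fst p \<in> ?\<xi> z \<inter> R then - (\<mu> * sin \<delta>) else 0) * z p)))
      \<in> borel_measurable (gauss_pairs \<sigma> E)" if "p \<in> E \<times> {True}" for p
  proof -
    have a: "(\<lambda>z. if fst p \<in> ?\<xi> z \<inter> R then - (\<mu> * sin \<delta>) else 0) \<in> borel_measurable (gauss_pairs \<sigma> E)"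
      by (rule measurable_compose[OF \<xi>]) simp
    have b: "(\<lambda>z. z p) \<in> borel_measurable (gauss_pairs \<sigma> E)"
      using that coordinate_measurable by (cases p) auto
    show ?thesis
      by (rule measurable_compose[OF borel_measurable_times[OF a b], of "\<lambda>x. ennreal (exp x)"]) simp
  qed
  then have G: "?G \<in> borel_measurable (gauss_pairs \<sigma> E)"
    by (intro borel_measurable_times_ennreal borel_measurable_prod_ennreal) (use U in simp)
  have B: "?B \<in> borel_measurable (gauss_pairs \<sigma> E)"
    by simp
  have "ennreal (exp (\<mu> * (max_sum S (\<lambda>e. z (e, False)) - max_sum S (\<lambda>e. rot R \<delta> z (e, False))))) \<le> ?G z" for z
  proof -
    let ?A = "?\<xi> z"
    have A: "?A \<in> S" "finite ?A" "?A \<subseteq> E"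
      using argmax_sum[OF S(1,2)] S(3) E finite_subset by metis+
    have "max_sum S (\<lambda>e. z (e, False)) - max_sum S (\<lambda>e. rot R \<delta> z (e, False)) \<le>
        (\<Sum>e\<in>?A. z (e, False)) - (\<Sum>e\<in>?A. rot R \<delta> z (e, False))"
      using sum_le_max_sum[OF S(1) A(1)] argmax_sum(2)[OF S(1,2)] by (smt (verit))
    also have "\<dots> = (\<Sum>e\<in>?A. z (e, False) - rot R \<delta> z (e, False))"
      by (simp add: sum_subtractf)
    also have "\<dots> \<le> (\<Sum>e\<in>?A. (1 - cos \<delta>) * \<bar>z (e, False)\<bar> + (if e \<in> ?A \<inter> R then - sin \<delta> else 0) * z (e, True))"
    proof (rule sum_mono)
      fix e assume "e \<in> ?A"
      have "(1 - cos \<delta>) * z (e, False) \<le> (1 - cos \<delta>) * \<bar>z (e, False)\<bar>"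
        by (intro mult_left_mono) auto
      moreover have "(1 - cos \<delta>) * \<bar>z (e, False)\<bar> \<ge> 0" by simp
      ultimately show "z (e, False) - rot R \<delta> z (e, False) \<le>
          (1 - cos \<delta>) * \<bar>z (e, False)\<bar> + (if e \<in> ?A \<inter> R then - sin \<delta> else 0) * z (e, True)"
        using \<open>e \<in> ?A\<close> by (auto simp: rot_def algebra_simps)
    qed
    also have "\<dots> \<le> (\<Sum>e\<in>E. (1 - cos \<delta>) * \<bar>z (e, False)\<bar> + (if e \<in> ?A \<inter> R then - sin \<delta> else 0) * z (e, True))"
      using A E by (intro sum_mono2) auto
    finally have "\<mu> * (max_sum S (\<lambda>e. z (e, False)) - max_sum S (\<lambda>e. rot R \<delta> z (e, False))) \<le>
        \<mu> * (\<Sum>e\<in>E. (1 - cos \<delta>) * \<bar>z (e, False)\<bar> + (if e \<in> ?A \<inter> R then - sin \<delta> else 0) * z (e, True))"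
      using \<mu> by (rule mult_left_mono)
    also have "\<dots> = ?U z + (\<Sum>e\<in>E. (if e \<in> ?A \<inter> R then - (\<mu> * sin \<delta>) else 0) * z (e, True))"
      unfolding sum_distrib_left sum.distrib[symmetric] by (intro sum.cong) (auto simp: algebra_simps)
    also have "(\<Sum>e\<in>E. (if e \<in> ?A \<inter> R then - (\<mu> * sin \<delta>) else 0) * z (e, True)) =
        (\<Sum>p\<in>E \<times> {True}. (if fst p \<in> ?A \<inter> R then - (\<mu> * sin \<delta>) else 0) * z p)"
      by (rule sum.reindex_bij_witness[where i = fst and j = "\<lambda>e. (e, True)"]) auto
    finally show ?thesis
      using E by (simp add: prod_ennreal flip: exp_sum exp_add ennreal_mult')
  qed
  then have "(\<integral>\<^sup>+z. ennreal (exp (\<mu> * (max_sum S (\<lambda>e. z (e, False)) - max_sum S (\<lambda>e. rot R \<delta> z (e, False))))) \<partial>gauss_pairs \<sigma> E)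
     \<le> (\<integral>\<^sup>+z. ?G z \<partial>gauss_pairs \<sigma> E)"
    by (intro nn_integral_mono)
  also have "\<dots> = (\<integral>\<^sup>+z. ?B z \<partial>gauss_pairs \<sigma> E)"
    unfolding gauss_pairs_fold[OF G] gauss_pairs_fold[OF B]
  proof (rule nn_integral_cong)
    fix x assume x: "x \<in> space (Pi\<^sub>M (E \<times> {False}) (\<lambda>_. gauss \<sigma>))"
    let ?m = "\<lambda>y. merge (E \<times> {False}) (E \<times> {True}) (x, y)"
    let ?A = "?\<xi> x \<inter> R"
    interpret T: prob_space "Pi\<^sub>M (E \<times> {True}) (\<lambda>_. gauss \<sigma>)"
      by (intro prob_space_PiM) unfold_locales
    have m: "?m y (e, False) = x (e, False)" for y e
      using x by (auto simp: merge_def space_PiM PiE_iff extensional_def)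
    have "(\<integral>\<^sup>+y. ?G (?m y) \<partial>Pi\<^sub>M (E \<times> {True}) (\<lambda>_. gauss \<sigma>)) =
       (\<integral>\<^sup>+y. ennreal (exp (?U x)) * (\<Prod>p\<in>E \<times> {True}. ennreal (exp ((if fst p \<in> ?A then - (\<mu> * sin \<delta>) else 0) * y p)))
          \<partial>Pi\<^sub>M (E \<times> {True}) (\<lambda>_. gauss \<sigma>))"
      unfolding m
      by (intro nn_integral_cong arg_cong2[where f = "(*)"] prod.cong refl) (auto simp: merge_def)
    also have "\<dots> = ennreal (exp (?U x)) *
       (\<integral>\<^sup>+y. (\<Prod>p\<in>E \<times> {True}. ennreal (exp ((if fst p \<in> ?A then - (\<mu> * sin \<delta>) else 0) * y p)))
          \<partial>Pi\<^sub>M (E \<times> {True}) (\<lambda>_. gauss \<sigma>))"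
      by (rule nn_integral_cmult) measurable
    also have "(\<integral>\<^sup>+y. (\<Prod>p\<in>E \<times> {True}. ennreal (exp ((if fst p \<in> ?A then - (\<mu> * sin \<delta>) else 0) * y p)))
          \<partial>Pi\<^sub>M (E \<times> {True}) (\<lambda>_. gauss \<sigma>)) =
       (\<Prod>p\<in>E \<times> {True}. \<integral>\<^sup>+y. ennreal (exp ((if fst p \<in> ?A then - (\<mu> * sin \<delta>) else 0) * y)) \<partial>gauss \<sigma>)"
      using E by (intro product_nn_integral_prod) auto
    also have "\<dots> = (\<Prod>p\<in>E \<times> {True}. ennreal (exp (if fst p \<in> ?A then (\<mu> * sin \<delta>)\<^sup>2 * \<sigma>\<^sup>2 / 2 else 0)))"
      by (intro prod.cong refl, subst gauss_mgf[OF \<sigma>]) auto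
    also have "\<dots> = ennreal (exp (\<Sum>p\<in>E \<times> {True}. if fst p \<in> ?A then (\<mu> * sin \<delta>)\<^sup>2 * \<sigma>\<^sup>2 / 2 else 0))"
      using E by (simp add: prod_ennreal exp_sum)
    also have "(\<Sum>p\<in>E \<times> {True}. if fst p \<in> ?A then (\<mu> * sin \<delta>)\<^sup>2 * \<sigma>\<^sup>2 / 2 else 0) =
        (\<Sum>e\<in>E. if e \<in> ?A then (\<mu> * sin \<delta>)\<^sup>2 * \<sigma>\<^sup>2 / 2 else 0)"
      by (rule sum.reindex_bij_witness[where i = "\<lambda>e. (e, True)" and j = fst]) auto
    also have "\<dots> = (\<mu> * sin \<delta>)\<^sup>2 * \<sigma>\<^sup>2 / 2 * card ?A"
    proof -
      have "E \<inter> {e. e \<in> ?A} = ?A" using R by auto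
      then show ?thesis unfolding sum.If_cases[OF E] by simp
    qed
    finally have "(\<integral>\<^sup>+y. ?G (?m y) \<partial>Pi\<^sub>M (E \<times> {True}) (\<lambda>_. gauss \<sigma>)) = ?B x"
      by (simp add: exp_add ennreal_mult')
    also have "?B x = (\<integral>\<^sup>+y. ?B x \<partial>Pi\<^sub>M (E \<times> {True}) (\<lambda>_. gauss \<sigma>))"
      by (simp add: T.emeasure_space_1)
    also have "\<dots> = (\<integral>\<^sup>+y. ?B (?m y) \<partial>Pi\<^sub>M (E \<times> {True}) (\<lambda>_. gauss \<sigma>))"
      unfolding m ..
    finally show "(\<integral>\<^sup>+y. ?G (?m y) \<partial>Pi\<^sub>M (E \<times> {True}) (\<lambda>_. gauss \<sigma>)) =
        (\<integral>\<^sup>+y. ?B (?m y) \<partial>Pi\<^sub>M (E \<times> {True}) (\<lambda>_. gauss \<sigma>))" .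
  qed
  finally show ?thesis .
qed

text \<open>By rotation invariance the configuration at angle \<open>\<alpha>\<close> may be taken as the starting point. No sign
  is imposed on \<open>\<beta> - \<alpha>\<close>, so that the circle can be traversed in both directions.\<close>

lemma max_sum_rotation_between:
  assumes R: "R \<subseteq> E" and S: "finite S" "S \<noteq> {}" "\<And>A. A \<in> S \<Longrightarrow> A \<subseteq> E" and \<mu>: "\<mu> \<ge> 0"
    and \<alpha>: "0 \<le> \<alpha>" "\<alpha> \<le> pi / 2"
  shows "(\<integral>\<^sup>+z. ennreal (exp (\<mu> * (max_sum S (\<lambda>e. rot R \<alpha> z (e, False)) - max_sum S (\<lambda>e. rot R \<beta> z (e, False))))) \<partial>gauss_pairs \<sigma> E)
    \<le> (\<integral>\<^sup>+z. ennreal (exp (\<mu> * (1 - cos (\<beta> - \<alpha>)) * (\<Sum>e\<in>E. \<bar>z (e, False)\<bar>) +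
         (\<mu> * sin (\<beta> - \<alpha>))\<^sup>2 * \<sigma>\<^sup>2 / 2 * card (argmax_sum S (\<lambda>e. z (e, False)) \<inter> R))) \<partial>gauss_pairs \<sigma> E)"
proof -
  let ?H = "\<lambda>z. ennreal (exp (\<mu> * (max_sum S (\<lambda>e. z (e, False)) - max_sum S (\<lambda>e. rot R (\<beta> - \<alpha>) z (e, False)))))"
  have f: "(\<lambda>z. max_sum S (\<lambda>e. z (e, False))) \<in> borel_measurable (gauss_pairs \<sigma> E)"
    by (rule max_sum_measurable[OF S]) (auto intro: coordinate_measurable)
  have "?H \<in> borel_measurable (gauss_pairs \<sigma> E)"
    using f measurable_compose[OF rot_measurable[OF R] f] by measurable
  from gauss_pairs_rot[OF E R \<alpha> \<sigma> this] show ?thesis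
    using max_sum_rotation_step[OF R S \<mu>, of "\<beta> - \<alpha>"] by (simp add: rot_add)
qed

text \<open>The quarter turn is divided into \<open>K\<close> steps of angle \<open>\<delta> = \<pi>/(2K)\<close>. With \<open>\<mu> = l K\<close> in each step,
  \<open>K (1 - cos \<delta>) \<le> 2/K\<close> and \<open>(K sin \<delta>)\<^sup>2/2 \<le> (\<pi>/2)\<^sup>2/2 \<le> 2\<close>. The sign \<open>s\<close> selects the direction in
  which the steps are traversed, because the maximiser used in a step has to be the one of the maximum
  with the positive sign.\<close>

lemma max_sum_resample:
  assumes R: "R \<subseteq> E" and S: "finite S" "S \<noteq> {}" "\<And>A. A \<in> S \<Longrightarrow> A \<subseteq> E" and l: "l \<ge> 0" and K: "K > 0"
    and s: "s = 1 \<or> s = -1"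
  shows "(\<integral>\<^sup>+z. ennreal (exp (s * l * (max_sum S (\<lambda>e. z (e, e \<in> R)) - max_sum S (\<lambda>e. z (e, False))))) \<partial>gauss_pairs \<sigma> E)
    \<le> (\<integral>\<^sup>+z. ennreal (exp (2 * l / real K * (\<Sum>e\<in>E. \<bar>z (e, False)\<bar>) +
         2 * l\<^sup>2 * \<sigma>\<^sup>2 * card (argmax_sum S (\<lambda>e. z (e, False)) \<inter> R))) \<partial>gauss_pairs \<sigma> E)"
    (is "_ \<le> ?B")
proof -
  define \<delta> where "\<delta> = pi / (2 * K)"
  define a where "a k z = max_sum S (\<lambda>e. rot R (real k * \<delta>) z (e, False))" for k :: nat and z
  have \<delta>: "0 < \<delta>" "\<delta> \<le> 2 / K" "K * \<delta> = pi / 2"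
    using K pi_less_4 by (auto simp: \<delta>_def field_simps)
  have a0: "a 0 z = max_sum S (\<lambda>e. z (e, False))" for z
    unfolding a_def by (intro arg_cong[where f = "max_sum S"]) (auto simp: rot_def fun_eq_iff)
  have aK: "a K z = max_sum S (\<lambda>e. z (e, e \<in> R))" for z
    unfolding a_def \<delta> by (intro arg_cong[where f = "max_sum S"]) (auto simp: rot_def fun_eq_iff)
  have am[measurable]: "a k \<in> borel_measurable (gauss_pairs \<sigma> E)" for k
  proof -
    have f: "(\<lambda>z. max_sum S (\<lambda>e. z (e, False))) \<in> borel_measurable (gauss_pairs \<sigma> E)"
      by (rule max_sum_measurable[OF S]) (auto intro: coordinate_measurable)
    show ?thesis
      using measurable_compose[OF rot_measurable[OF R] f] by (simp add: a_def[abs_def])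
  qed
  have "\<delta>\<^sup>2 \<le> (2 / K)\<^sup>2"
    using \<delta> by (intro power_mono) auto
  then have \<delta>2: "K * \<delta>\<^sup>2 / 2 \<le> 2 / K" "(K * \<delta>)\<^sup>2 / 2 \<le> 2"
    using K by (auto simp: field_simps power2_eq_square)
  have cosb: "l * K * (1 - cos \<delta>) \<le> 2 * l / K"
  proof -
    have "K * (1 - cos \<delta>) \<le> K * (\<delta>\<^sup>2 / 2)"
      using one_minus_cos_le[of \<delta>] by (intro mult_left_mono) auto
    also have "\<dots> \<le> 2 / K" using \<delta>2 by simp
    finally show ?thesis using mult_left_mono[OF _ l] by (fastforce simp: mult.assoc mult_ac)
  qed
  have sinb: "(l * K * sin \<delta>)\<^sup>2 * \<sigma>\<^sup>2 / 2 \<le> 2 * l\<^sup>2 * \<sigma>\<^sup>2"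
  proof -
    have "(K * sin \<delta>)\<^sup>2 \<le> (K * \<delta>)\<^sup>2"
      using abs_sin_x_le_abs_x[of \<delta>] by (simp add: power_mult_distrib abs_le_square_iff mult_left_mono)
    then have "(K * sin \<delta>)\<^sup>2 / 2 \<le> 2" using \<delta>2 by linarith
    then have "l\<^sup>2 * \<sigma>\<^sup>2 * ((K * sin \<delta>)\<^sup>2 / 2) \<le> l\<^sup>2 * \<sigma>\<^sup>2 * 2"
      by (intro mult_left_mono) auto
    then show ?thesis by (simp add: power_mult_distrib mult_ac)
  qed
  have step: "(\<integral>\<^sup>+z. ennreal (exp (- s * l * K * (a k z - a (Suc k) z))) \<partial>gauss_pairs \<sigma> E) \<le> ?B"
    if k: "k < K" for k
  proof -
    define \<alpha> \<beta> where "\<alpha> = (if s = 1 then real (Suc k) * \<delta> else real k * \<delta>)"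
      and "\<beta> = (if s = 1 then real k * \<delta> else real (Suc k) * \<delta>)"
    have "real (Suc k) * \<delta> \<le> K * \<delta>" using k \<delta> by (intro mult_right_mono) auto
    then have \<alpha>: "0 \<le> \<alpha>" "\<alpha> \<le> pi / 2"
      using \<delta> by (auto simp: \<alpha>_def algebra_simps)
    have \<alpha>\<beta>: "\<beta> - \<alpha> = \<delta> \<or> \<beta> - \<alpha> = - \<delta>"
      by (auto simp: \<alpha>_def \<beta>_def algebra_simps)
    have "l * K \<ge> 0" using l by simp
    have "- s * l * K * (a k z - a (Suc k) z) =
       l * K * (max_sum S (\<lambda>e. rot R \<alpha> z (e, False)) - max_sum S (\<lambda>e. rot R \<beta> z (e, False)))" for z
      using s by (auto simp: \<alpha>_def \<beta>_def a_def algebra_simps)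
    then have "(\<integral>\<^sup>+z. ennreal (exp (- s * l * K * (a k z - a (Suc k) z))) \<partial>gauss_pairs \<sigma> E) \<le>
       (\<integral>\<^sup>+z. ennreal (exp (l * K * (1 - cos (\<beta> - \<alpha>)) * (\<Sum>e\<in>E. \<bar>z (e, False)\<bar>) +
         (l * K * sin (\<beta> - \<alpha>))\<^sup>2 * \<sigma>\<^sup>2 / 2 * card (argmax_sum S (\<lambda>e. z (e, False)) \<inter> R))) \<partial>gauss_pairs \<sigma> E)"
      using max_sum_rotation_between[OF R S \<open>l * K \<ge> 0\<close> \<alpha>] by simp
    also have "\<dots> = (\<integral>\<^sup>+z. ennreal (exp (l * K * (1 - cos \<delta>) * (\<Sum>e\<in>E. \<bar>z (e, False)\<bar>) +
         (l * K * sin \<delta>)\<^sup>2 * \<sigma>\<^sup>2 / 2 * card (argmax_sum S (\<lambda>e. z (e, False)) \<inter> R))) \<partial>gauss_pairs \<sigma> E)"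
      using \<alpha>\<beta> by auto
    also have "\<dots> \<le> ?B"
      by (intro nn_integral_mono ennreal_leI iffD2[OF exp_le_cancel_iff] add_mono mult_right_mono
          cosb sinb sum_nonneg) auto
    finally show ?thesis .
  qed
  have "exp (s * l * (a K z - a 0 z)) \<le> (\<Sum>k<K. exp (- s * l * K * (a k z - a (Suc k) z)) / K)" for z
    using exp_telescope_le[OF K, of "- s * l" "\<lambda>k. a k z"] by (simp add: algebra_simps)
  then have "(\<integral>\<^sup>+z. ennreal (exp (s * l * (a K z - a 0 z))) \<partial>gauss_pairs \<sigma> E) \<le>
     (\<integral>\<^sup>+z. ennreal (\<Sum>k<K. exp (- s * l * K * (a k z - a (Suc k) z)) / K) \<partial>gauss_pairs \<sigma> E)"
    by (intro nn_integral_mono ennreal_leI)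
  also have "\<dots> = (\<integral>\<^sup>+z. (\<Sum>k<K. ennreal (1 / K) * ennreal (exp (- s * l * K * (a k z - a (Suc k) z)))) \<partial>gauss_pairs \<sigma> E)"
    by (simp add: sum_ennreal flip: ennreal_mult')
  also have "\<dots> = (\<Sum>k<K. ennreal (1 / K) * (\<integral>\<^sup>+z. ennreal (exp (- s * l * K * (a k z - a (Suc k) z))) \<partial>gauss_pairs \<sigma> E))"
    by (simp add: nn_integral_sum nn_integral_cmult)
  also have "\<dots> \<le> (\<Sum>k<K. ennreal (1 / K) * ?B)"
    by (intro sum_mono mult_left_mono step) auto
  also have "\<dots> = ?B"
    using K by (simp add: ennreal_of_nat_eq_real_of_nat flip: mult.assoc ennreal_mult')
  finally show ?thesis by (simp only: a0 aK)
qed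

end

text \<open>Only finiteness matters: this controls the error term of \<open>max_sum_resample\<close>, whose coefficient
  tends to zero.\<close>

lemma gauss_pairs_exp_abs_sum_finite:
  fixes E :: "'e set"
  assumes \<sigma>: "\<sigma> > 0" and E: "finite E"
  shows "(\<integral>\<^sup>+z. ennreal (exp (\<Sum>e\<in>E. \<bar>z (e, False)\<bar>)) \<partial>gauss_pairs \<sigma> E) < \<infinity>"
proof -
  interpret N: prob_space "gauss \<sigma>" using prob_space_normal_density[OF \<sigma>] .
  interpret product_prob_space "\<lambda>_ :: 'e \<times> bool. gauss \<sigma>" ..
  have "(\<integral>\<^sup>+z. ennreal (exp (\<Sum>e\<in>E. \<bar>z (e, False)\<bar>)) \<partial>gauss_pairs \<sigma> E) \<le>
      (\<integral>\<^sup>+z. (\<Prod>p\<in>E \<times> UNIV. ennreal (exp (1 * z p)) + ennreal (exp (-1 * z p))) \<partial>gauss_pairs \<sigma> E)"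
  proof (rule nn_integral_mono)
    fix z :: "'e \<times> bool \<Rightarrow> real"
    have "(\<Sum>e\<in>E. \<bar>z (e, False)\<bar>) = (\<Sum>p\<in>E \<times> {False}. \<bar>z p\<bar>)"
      by (rule sum.reindex_bij_witness[where i = fst and j = "\<lambda>e. (e, False)"]) auto
    also have "\<dots> \<le> (\<Sum>p\<in>E \<times> UNIV. \<bar>z p\<bar>)"
      using E by (intro sum_mono2) auto
    finally have "exp (\<Sum>e\<in>E. \<bar>z (e, False)\<bar>) \<le> exp (\<Sum>p\<in>E \<times> UNIV. \<bar>z p\<bar>)" by simp
    also have "\<dots> = (\<Prod>p\<in>E \<times> UNIV. exp \<bar>z p\<bar>)" using E by (simp add: exp_sum)
    also have "\<dots> \<le> (\<Prod>p\<in>E \<times> UNIV. exp (z p) + exp (- z p))"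
      by (intro prod_mono) (auto simp: abs_if)
    finally show "ennreal (exp (\<Sum>e\<in>E. \<bar>z (e, False)\<bar>)) \<le> (\<Prod>p\<in>E \<times> UNIV. ennreal (exp (1 * z p)) + ennreal (exp (-1 * z p)))"
      by (simp add: prod_ennreal ennreal_leI flip: ennreal_plus)
  qed
  also have "\<dots> = (\<Prod>p\<in>E \<times> (UNIV :: bool set). \<integral>\<^sup>+x. ennreal (exp (1 * x)) + ennreal (exp (-1 * x)) \<partial>gauss \<sigma>)"
    using E by (intro product_nn_integral_prod) auto
  also have "\<dots> = (\<Prod>p\<in>E \<times> (UNIV :: bool set). ennreal (2 * exp (\<sigma>\<^sup>2 / 2)))"
    by (subst nn_integral_add, simp, simp, subst (1 2) gauss_mgf[OF \<sigma>])
       (simp flip: ennreal_plus)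
  also have "\<dots> < \<infinity>" by (simp add: ennreal_power)
  finally show ?thesis .
qed

section \<open>Independent families\<close>

lemma (in prob_space) indep_sets_reindex:
  assumes f: "inj_on f I" and ind: "indep_sets F (f ` I)"
  shows "indep_sets (\<lambda>i. F (f i)) I"
proof (rule indep_setsI)
  show "F (f i) \<subseteq> events" if "i \<in> I" for i
    using ind that by (auto simp: indep_sets_def)
next
  fix A J assume J: "J \<noteq> {}" "J \<subseteq> I" "finite J" "\<forall>j\<in>J. A j \<in> F (f j)"
  define A' where "A' k = A (the_inv_into J f k)" for k
  have fJ: "inj_on f J" using f J(2) by (rule inj_on_subset)
  then have A': "A' (f j) = A j" if "j \<in> J" for j
    using that by (simp add: A'_def the_inv_into_f_f)
  have "prob (\<Inter>k\<in>f ` J. A' k) = (\<Prod>k\<in>f ` J. prob (A' k))"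
    using J A' by (intro indep_setsD[OF ind]) auto
  then show "prob (\<Inter>j\<in>J. A j) = (\<Prod>j\<in>J. prob (A j))"
    using fJ A' by (simp add: prod.reindex)
qed

lemma (in prob_space) indep_vars_reindex:
  assumes "inj_on f I" "indep_vars (\<lambda>_. N) X (f ` I)"
  shows "indep_vars (\<lambda>_. N) (\<lambda>i. X (f i)) I"
  using assms indep_sets_reindex[of f I "\<lambda>i. {X i -` A \<inter> space M | A. A \<in> sets N}"]
  unfolding indep_vars_def2 by auto

text \<open>Independence between groups and independence within each group combine to independence of the
  whole family, because a finite intersection of events of one group is again an event of the
  \<open>\<sigma>\<close>-algebra of that group.\<close>

lemma (in prob_space) indep_sets_nested:
  assumes ind: "indep_sets F I" and sub: "\<And>i. i \<in> I \<Longrightarrow> indep_sets (G i) (J i)"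
    and F: "\<And>i. i \<in> I \<Longrightarrow> sigma_algebra (space M) (F i)"
    and GF: "\<And>i j. i \<in> I \<Longrightarrow> j \<in> J i \<Longrightarrow> G i j \<subseteq> F i"
  shows "indep_sets (\<lambda>(i, j). G i j) (Sigma I J)"
proof (rule indep_setsI)
  show "(\<lambda>(i, j). G i j) p \<subseteq> events" if "p \<in> Sigma I J" for p
    using that sub by (auto simp: indep_sets_def)
next
  fix A T assume T: "T \<noteq> {}" "T \<subseteq> Sigma I J" "finite T" "\<forall>p\<in>T. A p \<in> (\<lambda>(i, j). G i j) p"
  define T1 where "T1 = fst ` T"
  define T2 where "T2 i = {j. (i, j) \<in> T}" for i
  define D where "D i = (\<Inter>j\<in>T2 i. A (i, j))" for i
  have TS: "T = Sigma T1 T2" by (force simp: T1_def T2_def)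
  have T1: "finite T1" "T1 \<noteq> {}" "T1 \<subseteq> I" using T by (auto simp: T1_def)
  have T2: "finite (T2 i)" "T2 i \<noteq> {}" "T2 i \<subseteq> J i" if "i \<in> T1" for i
  proof -
    have "T2 i \<subseteq> snd ` T" by (force simp: T2_def)
    then show "finite (T2 i)" using T(3) finite_subset by blast
    show "T2 i \<noteq> {}" "T2 i \<subseteq> J i" using that T(2) by (auto simp: T1_def T2_def)
  qed
  have AG: "A (i, j) \<in> G i j" if "i \<in> T1" "j \<in> T2 i" for i j
    using T(4) that by (auto simp: TS)
  have D: "D i \<in> F i" if i: "i \<in> T1" for i
  proof -
    have "i \<in> I" using T1 i by auto
    interpret Fi: sigma_algebra "space M" "F i" by (rule F) fact
    show ?thesis
      unfolding D_def using T2[OF i] AG[OF i] GF[OF \<open>i \<in> I\<close>] by (intro Fi.finite_INT) blast+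
  qed
  have "(\<Inter>p\<in>T. A p) = (\<Inter>i\<in>T1. D i)" by (auto simp: TS D_def)
  also have "prob \<dots> = (\<Prod>i\<in>T1. prob (D i))"
    using T1 D by (intro indep_setsD[OF ind]) auto
  also have "\<dots> = (\<Prod>i\<in>T1. \<Prod>j\<in>T2 i. prob (A (i, j)))"
  proof (rule prod.cong[OF refl])
    fix i assume i: "i \<in> T1"
    then show "prob (D i) = (\<Prod>j\<in>T2 i. prob (A (i, j)))"
      unfolding D_def using T1 T2[OF i] AG[OF i] by (intro indep_setsD[OF sub[of i]]) auto
  qed
  also have "\<dots> = (\<Prod>p\<in>T. prob (A p))"
    unfolding TS using T1 T2 by (subst prod.Sigma) auto
  finally show "prob (\<Inter>p\<in>T. A p) = (\<Prod>p\<in>T. prob (A p))" .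
qed

lemma (in prob_space) indep_sets_singleton:
  "F i \<subseteq> events \<Longrightarrow> indep_sets F {i}"
  by (rule indep_setsI) (auto simp: subset_singleton_iff)

lemma (in prob_space) indep_var_nn_integral:
  fixes X Y :: "'a \<Rightarrow> ennreal"
  assumes "indep_var borel X borel Y"
  shows "(\<integral>\<^sup>+\<omega>. X \<omega> * Y \<omega> \<partial>M) = (\<integral>\<^sup>+\<omega>. X \<omega> \<partial>M) * (\<integral>\<^sup>+\<omega>. Y \<omega> \<partial>M)"
proof -
  have "indep_vars (\<lambda>_. borel) (case_bool X Y) UNIV"
    using assms unfolding indep_var_def by (rule indep_vars_cong[THEN iffD1, rotated -1]) (auto split: bool.split)
  from indep_vars_nn_integral[OF _ this] show ?thesis
    by (simp add: UNIV_bool mult.commute)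
qed

section \<open>Averaging over the clocks\<close>

lemma exp_le_1_plus_2x: "exp x \<le> 1 + 2 * x" if "0 \<le> x" "x \<le> 1" for x :: real
proof -
  have "x\<^sup>2 \<le> x * 1" unfolding power2_eq_square using that by (intro mult_left_mono) auto
  then show ?thesis using exp_bound[OF that] by simp
qed

text \<open>Each factor is at most \<open>1 + p (exp y - 1) \<le> 1 + 2 p y \<le> exp (2 p y)\<close>.\<close>

lemma (in prob_space) exp_sum_indep_events_le:
  fixes c :: "'v \<Rightarrow> 'a \<Rightarrow> real" and y :: "'v \<Rightarrow> real"
  assumes V: "finite V" and c: "indep_vars (\<lambda>_. borel) c V"
    and p: "\<And>v. v \<in> V \<Longrightarrow> \<P>(\<omega> in M. c v \<omega> \<noteq> 0) \<le> p"
    and y: "\<And>v. v \<in> V \<Longrightarrow> 0 \<le> y v" "\<And>v. v \<in> V \<Longrightarrow> y v \<le> 1"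
  shows "(\<integral>\<^sup>+\<omega>. ennreal (exp (\<Sum>v\<in>V. if c v \<omega> \<noteq> 0 then y v else 0)) \<partial>M) \<le> ennreal (exp (2 * p * (\<Sum>v\<in>V. y v)))"
proof -
  let ?h = "\<lambda>v x. ennreal (exp (if x \<noteq> 0 then y v else 0))"
  have h: "indep_vars (\<lambda>_. borel) (\<lambda>v \<omega>. ?h v (c v \<omega>)) V"
    by (rule indep_vars_compose2[OF c]) simp
  have "(\<integral>\<^sup>+\<omega>. ennreal (exp (\<Sum>v\<in>V. if c v \<omega> \<noteq> 0 then y v else 0)) \<partial>M) = (\<integral>\<^sup>+\<omega>. (\<Prod>v\<in>V. ?h v (c v \<omega>)) \<partial>M)"
    using V by (simp add: exp_sum prod_ennreal)
  also have "\<dots> = (\<Prod>v\<in>V. \<integral>\<^sup>+\<omega>. ?h v (c v \<omega>) \<partial>M)"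
    by (rule indep_vars_nn_integral[OF V h]) simp
  also have "\<dots> \<le> (\<Prod>v\<in>V. ennreal (exp (2 * p * y v)))"
  proof (rule prod_mono_ennreal)
    fix v assume v: "v \<in> V"
    have [measurable]: "c v \<in> borel_measurable M" using c v by (auto simp: indep_vars_def)
    have p0: "0 \<le> p" using p[OF v] measure_nonneg order_trans by blast
    let ?A = "{\<omega> \<in> space M. c v \<omega> \<noteq> 0}"
    have "(\<integral>\<^sup>+\<omega>. ?h v (c v \<omega>) \<partial>M) \<le> (\<integral>\<^sup>+\<omega>. ennreal 1 + ennreal (2 * y v) * indicator ?A \<omega> \<partial>M)"
      using y[OF v] exp_le_1_plus_2x[OF y(1)[OF v] y(2)[OF v]]
      by (intro nn_integral_mono)
         (auto simp: indicator_def simp del: ennreal_1 simp flip: ennreal_plus ennreal_mult' intro!: ennreal_leI)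
    also have "\<dots> = 1 + ennreal (2 * y v) * emeasure M ?A"
      by (subst nn_integral_add) (auto simp: nn_integral_cmult emeasure_space_1)
    also have "\<dots> = ennreal (1 + 2 * y v * prob ?A)"
      using y[OF v] by (simp add: emeasure_eq_measure ennreal_mult' flip: ennreal_1)
    also have "\<dots> \<le> ennreal (exp (2 * p * y v))"
    proof (rule ennreal_leI)
      have "2 * y v * prob ?A \<le> 2 * y v * p" using y[OF v] p[OF v] by (intro mult_left_mono) auto
      also have "1 + \<dots> \<le> exp (2 * y v * p)" by (rule exp_ge_add_one_self)
      finally show "1 + 2 * y v * prob ?A \<le> exp (2 * p * y v)" by (simp add: mult_ac)
    qed
    finally show "(\<integral>\<^sup>+\<omega>. ?h v (c v \<omega>) \<partial>M) \<le> ennreal (exp (2 * p * y v))" .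
  qed
  also have "\<dots> = ennreal (exp (2 * p * (\<Sum>v\<in>V. y v)))"
    using V by (simp add: prod_ennreal exp_sum sum_distrib_left)
  finally show ?thesis .
qed

text \<open>On the event that the clocks in \<open>V\<close> show the values \<open>\<kappa>\<close>, the variables that matter are finitely
  many of the \<open>G e k\<close>, selected by an injection \<open>\<phi>\<close> that may be chosen according to \<open>\<kappa>\<close>. They are
  independent of this event and distributed as a Gaussian configuration with its copy.\<close>

lemma (in prob_space) nn_integral_split_clocks:
  fixes c :: "'v \<Rightarrow> 'a \<Rightarrow> int" and G :: "'e \<Rightarrow> int \<Rightarrow> 'a \<Rightarrow> real"
    and H :: "('e \<times> bool \<Rightarrow> real) \<Rightarrow> ennreal"
  assumes V: "finite V" and E: "finite E" "E \<noteq> {}" and \<sigma>: "\<sigma> > 0"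
    and ind: "indep_vars (\<lambda>_. borel) (case_sum (\<lambda>v \<omega>. real_of_int (c v \<omega>)) (\<lambda>(e, k). G e k)) (V <+> E \<times> UNIV)"
    and G: "\<And>e k. e \<in> E \<Longrightarrow> distr M borel (G e k) = gauss \<sigma>"
    and \<phi>: "inj_on \<phi> (E \<times> UNIV)" "\<phi> ` (E \<times> UNIV) \<subseteq> E \<times> UNIV"
    and H: "H \<in> borel_measurable (gauss_pairs \<sigma> E)"
  shows "(\<integral>\<^sup>+\<omega>. indicator {\<omega>. \<forall>v\<in>V. c v \<omega> = \<kappa> v} \<omega> * H (\<lambda>p\<in>E \<times> UNIV. case_prod G (\<phi> p) \<omega>) \<partial>M) =
    emeasure M {\<omega> \<in> space M. \<forall>v\<in>V. c v \<omega> = \<kappa> v} * (\<integral>\<^sup>+z. H z \<partial>gauss_pairs \<sigma> E)"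
proof -
  let ?Y = "case_sum (\<lambda>v \<omega>. real_of_int (c v \<omega>)) (\<lambda>(e, k). G e k)"
  let ?A = "Inl ` V :: ('v + 'e \<times> int) set" and ?B = "Inr ` \<phi> ` (E \<times> UNIV) :: ('v + 'e \<times> int) set"
  let ?f = "\<lambda>w. (\<Prod>v\<in>V. indicator {real_of_int (\<kappa> v)} (w (Inl v :: 'v + 'e \<times> int))) :: ennreal"
  let ?g = "\<lambda>w :: ('v + 'e \<times> int) \<Rightarrow> real. \<lambda>p\<in>E \<times> UNIV. w (Inr (\<phi> p))"
  let ?Z = "\<lambda>\<omega>. \<lambda>p\<in>E \<times> UNIV. case_prod G (\<phi> p) \<omega>"
  have AB: "?A \<inter> ?B = {}" "?A \<subseteq> V <+> E \<times> UNIV" "?B \<subseteq> V <+> E \<times> UNIV"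
    using \<phi>(2) by auto
  have f: "?f \<in> borel_measurable (Pi\<^sub>M ?A (\<lambda>_. borel))"
    by (intro borel_measurable_prod_ennreal measurable_compose[OF measurable_component_singleton]) auto
  have "?g \<in> measurable (Pi\<^sub>M ?B (\<lambda>_. borel)) (gauss_pairs \<sigma> E)"
  proof (rule measurable_restrict)
    fix p :: "'e \<times> bool" assume "p \<in> E \<times> UNIV"
    then show "(\<lambda>w. w (Inr (\<phi> p))) \<in> measurable (Pi\<^sub>M ?B (\<lambda>_. borel :: real measure)) (gauss \<sigma>)"
      using measurable_component_singleton[of "Inr (\<phi> p)" ?B "\<lambda>_. borel :: real measure"] by auto
  qed
  from measurable_compose[OF this H]
  have g: "(\<lambda>w. H (?g w)) \<in> borel_measurable (Pi\<^sub>M ?B (\<lambda>_. borel))" .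
  have "indep_var borel (?f \<circ> (\<lambda>\<omega>. restrict (\<lambda>i. ?Y i \<omega>) ?A)) borel ((\<lambda>w. H (?g w)) \<circ> (\<lambda>\<omega>. restrict (\<lambda>i. ?Y i \<omega>) ?B))"
    by (rule indep_var_compose[OF indep_var_restrict[OF ind AB] f g])
  moreover have "?f \<circ> (\<lambda>\<omega>. restrict (\<lambda>i. ?Y i \<omega>) ?A) = indicator {\<omega>. \<forall>v\<in>V. c v \<omega> = \<kappa> v}"
  proof
    fix \<omega>
    have "(\<Prod>v\<in>V. indicator {real_of_int (\<kappa> v)} (real_of_int (c v \<omega>)) :: ennreal) = indicator {\<omega>. \<forall>v\<in>V. c v \<omega> = \<kappa> v} \<omega>"
      using V by (auto simp: indicator_def)
    then show "(?f \<circ> (\<lambda>\<omega>. restrict (\<lambda>i. ?Y i \<omega>) ?A)) \<omega> = indicator {\<omega>. \<forall>v\<in>V. c v \<omega> = \<kappa> v} \<omega>"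
      by (simp cong: prod.cong)
  qed
  moreover have "((\<lambda>w. H (?g w)) \<circ> (\<lambda>\<omega>. restrict (\<lambda>i. ?Y i \<omega>) ?B)) = (\<lambda>\<omega>. H (?Z \<omega>))"
    by (auto simp: fun_eq_iff restrict_def split_beta intro!: arg_cong[where f = H])
  ultimately have "indep_var borel (indicator {\<omega>. \<forall>v\<in>V. c v \<omega> = \<kappa> v}) borel (\<lambda>\<omega>. H (?Z \<omega>))"
    by simp
  note this[THEN indep_var_nn_integral]
  moreover have "(\<integral>\<^sup>+\<omega>. H (?Z \<omega>) \<partial>M) = (\<integral>\<^sup>+z. H z \<partial>gauss_pairs \<sigma> E)"
  proof -
    have "indep_vars (\<lambda>_. borel) ?Y ((\<lambda>p. Inr (\<phi> p)) ` (E \<times> UNIV))"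
      by (rule indep_vars_subset[OF ind]) (use \<phi>(2) in auto)
    from indep_vars_reindex[OF _ this]
    have "indep_vars (\<lambda>_. borel) (\<lambda>p. case_prod G (\<phi> p)) (E \<times> (UNIV :: bool set))"
      using \<phi>(1) by (simp add: comp_def inj_on_def split_beta)
    moreover from this have m: "case_prod G (\<phi> p) \<in> borel_measurable M" if "p \<in> E \<times> UNIV" for p :: "'e \<times> bool"
      using that unfolding indep_vars_def by blast
    ultimately have "distr M (Pi\<^sub>M (E \<times> UNIV) (\<lambda>_. borel)) ?Z = Pi\<^sub>M (E \<times> UNIV) (\<lambda>p. distr M borel (case_prod G (\<phi> p)))"
      by (subst (asm) indep_vars_iff_distr_eq_PiM') (use E in auto)
    also have "\<dots> = gauss_pairs \<sigma> E"
      using \<phi>(2) by (intro PiM_cong refl) (auto simp: split_beta image_subset_iff mem_Times_iff intro!: G)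
    finally have D: "distr M (Pi\<^sub>M (E \<times> UNIV) (\<lambda>_. borel)) ?Z = gauss_pairs \<sigma> E" .
    have "H \<in> borel_measurable (distr M (Pi\<^sub>M (E \<times> UNIV) (\<lambda>_. borel)) ?Z)"
      unfolding D by (rule H)
    then have "(\<integral>\<^sup>+z. H z \<partial>distr M (Pi\<^sub>M (E \<times> UNIV) (\<lambda>_. borel)) ?Z) = (\<integral>\<^sup>+\<omega>. H (?Z \<omega>) \<partial>M)"
      by (intro nn_integral_distr measurable_restrict m) auto
    then show ?thesis unfolding D by simp
  qed
  moreover have "(\<integral>\<^sup>+\<omega>. indicator {\<omega>. \<forall>v\<in>V. c v \<omega> = \<kappa> v} \<omega> \<partial>M) = emeasure M {\<omega> \<in> space M. \<forall>v\<in>V. c v \<omega> = \<kappa> v}"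
  proof -
    have "{\<omega> \<in> space M. \<forall>v\<in>V. c v \<omega> = \<kappa> v} = {\<omega> \<in> space M. \<forall>v\<in>V. real_of_int (c v \<omega>) = real_of_int (\<kappa> v)}"
      by simp
    moreover have "(\<lambda>\<omega>. real_of_int (c v \<omega>)) \<in> borel_measurable M" if "v \<in> V" for v
      using ind that unfolding indep_vars_def by force
    then have "{\<omega> \<in> space M. \<forall>v\<in>V. real_of_int (c v \<omega>) = real_of_int (\<kappa> v)} \<in> sets M"
      using V by measurable
    ultimately have ev: "{\<omega> \<in> space M. \<forall>v\<in>V. c v \<omega> = \<kappa> v} \<in> sets M" by simp
    show ?thesis
      unfolding nn_integral_indicator[OF ev, symmetric]
      by (intro nn_integral_cong) (auto simp: indicator_def)
  qed
  ultimately show ?thesis by simp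
qed

text \<open>The values of the clocks are decomposed into countably many cases \<open>\<kappa>\<close>. In each case the cells of
  the blocks that have rung form a deterministic set \<open>R \<kappa>\<close>, to which \<open>max_sum_resample\<close> applies. The
  resulting bounds are then summed over \<open>\<kappa>\<close> for a fixed configuration, hence for a fixed maximiser
  \<open>A\<close>. Since \<open>\<sigma>\<^sup>2 |A \<inter> R \<kappa>|\<close> is a sum over the blocks that have rung, independence of the clocks
  yields a bound that is uniform in the configuration.\<close>

lemma (in prob_space) exp_max_sum_resample_clocks:
  fixes c :: "'v \<Rightarrow> 'a \<Rightarrow> int" and G :: "'e \<Rightarrow> int \<Rightarrow> 'a \<Rightarrow> real" and block :: "'e \<Rightarrow> 'v"
  assumes V: "finite V" and E: "finite E" "E \<noteq> {}" "block ` E \<subseteq> V" and \<sigma>: "\<sigma> > 0"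
    and ind: "indep_vars (\<lambda>_. borel) (case_sum (\<lambda>v \<omega>. real_of_int (c v \<omega>)) (\<lambda>(e, k). G e k)) (V <+> E \<times> UNIV)"
    and G: "\<And>e k. e \<in> E \<Longrightarrow> distr M borel (G e k) = gauss \<sigma>"
    and p: "\<And>v. v \<in> V \<Longrightarrow> \<P>(\<omega> in M. c v \<omega> \<noteq> 0) \<le> p"
    and S: "finite S" "S \<noteq> {}" "\<And>A. A \<in> S \<Longrightarrow> A \<subseteq> E"
    and len: "\<And>A. A \<in> S \<Longrightarrow> \<sigma>\<^sup>2 * card A \<le> L"
    and blk: "\<And>A v. A \<in> S \<Longrightarrow> v \<in> V \<Longrightarrow> \<sigma>\<^sup>2 * card {e \<in> A. block e = v} \<le> 1"
    and l: "l \<ge> 0" "2 * l\<^sup>2 \<le> 1" and p0: "p \<ge> 0"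
    and s: "s = 1 \<or> s = -1"
  shows "(\<integral>\<^sup>+\<omega>. ennreal (exp (s * l * (max_sum S (\<lambda>e. G e (c (block e) \<omega>) \<omega>) - max_sum S (\<lambda>e. G e 0 \<omega>)))) \<partial>M)
    \<le> ennreal (exp (4 * l\<^sup>2 * p * L))"
    (is "(\<integral>\<^sup>+\<omega>. ?F \<omega> \<partial>M) \<le> _")
proof -
  define C where "C = (V \<rightarrow>\<^sub>E (UNIV :: int set))"
  have C: "countable C" unfolding C_def using V by (intro countable_PiE) auto
  define \<kappa>0 where "\<kappa>0 \<omega> = restrict (\<lambda>v. c v \<omega>) V" for \<omega>
  have \<kappa>0: "\<kappa>0 \<omega> \<in> C" for \<omega> by (auto simp: \<kappa>0_def C_def)
  have ev: "(\<forall>v\<in>V. c v \<omega> = \<kappa> v) \<longleftrightarrow> \<kappa> = \<kappa>0 \<omega>" if "\<kappa> \<in> C" for \<kappa> \<omega>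
    using that by (auto simp: \<kappa>0_def C_def PiE_iff extensional_def fun_eq_iff)
  let ?I = "\<lambda>\<kappa>. indicator {\<omega>. \<forall>v\<in>V. c v \<omega> = \<kappa> v} :: 'a \<Rightarrow> ennreal"
  have cm: "(\<lambda>\<omega>. real_of_int (c v \<omega>)) \<in> borel_measurable M" if "v \<in> V" for v
    using ind that unfolding indep_vars_def by force
  have Gm: "G e k \<in> borel_measurable M" if "e \<in> E" for e k
    using ind that unfolding indep_vars_def by force
  have evm: "{\<omega> \<in> space M. \<forall>v\<in>V. c v \<omega> = \<kappa> v} \<in> sets M" for \<kappa>
  proof -
    have "{\<omega> \<in> space M. \<forall>v\<in>V. real_of_int (c v \<omega>) = real_of_int (\<kappa> v)} \<in> sets M"
      using V cm by measurable
    then show ?thesis by simp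
  qed
  have Im[measurable]: "?I \<kappa> \<in> borel_measurable M" for \<kappa>
  proof -
    have "?I \<kappa> \<in> borel_measurable M \<longleftrightarrow>
        (indicator {\<omega> \<in> space M. \<forall>v\<in>V. c v \<omega> = \<kappa> v} :: 'a \<Rightarrow> ennreal) \<in> borel_measurable M"
      by (rule measurable_cong) (auto simp: indicator_def)
    then show ?thesis using evm by simp
  qed
  have select: "(\<integral>\<^sup>+\<kappa>. ?I \<kappa> \<omega> * g \<kappa> \<partial>count_space C) = g (\<kappa>0 \<omega>)" for \<omega> and g :: "_ \<Rightarrow> ennreal"
  proof -
    have "(\<integral>\<^sup>+\<kappa>. ?I \<kappa> \<omega> * g \<kappa> \<partial>count_space C) = (\<integral>\<^sup>+\<kappa>. g \<kappa> * indicator {\<kappa>0 \<omega>} \<kappa> \<partial>count_space C)"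
      by (intro nn_integral_cong) (auto simp: indicator_def ev)
    also have "\<dots> = g (\<kappa>0 \<omega>)"
      using \<kappa>0 by (subst nn_integral_indicator_singleton) auto
    finally show ?thesis .
  qed
  define R where "R \<kappa> = {e \<in> E. \<kappa> (block e) \<noteq> 0}" for \<kappa> :: "'v \<Rightarrow> int"
  \<comment> \<open>The copy of a cell comes from the path installed at its last ring. If its block has not rung, the
    copy is never looked at, and path 1 serves as a path different from path 0.\<close>
  define \<phi> where "\<phi> \<kappa> = (\<lambda>(e, b). (e, if b then (if \<kappa> (block e) = 0 then 1 else \<kappa> (block e)) else 0))"
    for \<kappa> :: "'v \<Rightarrow> int"
  have \<phi>: "inj_on (\<phi> \<kappa>) (E \<times> UNIV)" "\<phi> \<kappa> ` (E \<times> UNIV) \<subseteq> E \<times> UNIV" for \<kappa>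
    by (auto simp: \<phi>_def inj_on_def split: if_splits)
  define Z where "Z \<kappa> \<omega> = (\<lambda>p\<in>E \<times> UNIV. case_prod G (\<phi> \<kappa> p) \<omega>)" for \<kappa> \<omega>
  define H where "H \<kappa> z = ennreal (exp (s * l * (max_sum S (\<lambda>e. z (e, e \<in> R \<kappa>)) - max_sum S (\<lambda>e. z (e, False)))))"
    for \<kappa> and z :: "'e \<times> bool \<Rightarrow> real"
  define P where "P \<kappa> = emeasure M {\<omega> \<in> space M. \<forall>v\<in>V. c v \<omega> = \<kappa> v}" for \<kappa>
  let ?\<Gamma> = "gauss_pairs \<sigma> E"
  let ?\<xi> = "\<lambda>z :: 'e \<times> bool \<Rightarrow> real. argmax_sum S (\<lambda>e. z (e, False))"
  have Hm: "H \<kappa> \<in> borel_measurable ?\<Gamma>" for \<kappa>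
  proof -
    have [measurable]: "(\<lambda>z. max_sum S (\<lambda>e. z (e, b e))) \<in> borel_measurable ?\<Gamma>" for b
      by (rule max_sum_measurable[OF S]) (auto intro: coordinate_measurable[OF \<sigma> E(1)])
    show ?thesis unfolding H_def by measurable
  qed
  have F: "?F \<omega> = H (\<kappa>0 \<omega>) (Z (\<kappa>0 \<omega>) \<omega>)" for \<omega>
  proof -
    have "max_sum S (\<lambda>e. G e (c (block e) \<omega>) \<omega>) = max_sum S (\<lambda>e. Z (\<kappa>0 \<omega>) \<omega> (e, e \<in> R (\<kappa>0 \<omega>)))"
      by (rule max_sum_cong[OF S(3)]) (use E(3) in \<open>auto simp: Z_def \<phi>_def R_def \<kappa>0_def\<close>)
    moreover have "max_sum S (\<lambda>e. G e 0 \<omega>) = max_sum S (\<lambda>e. Z (\<kappa>0 \<omega>) \<omega> (e, False))"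
      by (rule max_sum_cong[OF S(3)]) (auto simp: Z_def \<phi>_def)
    ultimately show ?thesis by (simp add: H_def)
  qed
  have HZm: "(\<lambda>\<omega>. H \<kappa> (Z \<kappa> \<omega>)) \<in> borel_measurable M" for \<kappa>
  proof (rule measurable_compose[OF _ Hm])
    show "Z \<kappa> \<in> measurable M ?\<Gamma>"
      unfolding Z_def by (rule measurable_restrict) (auto simp: \<phi>_def intro: Gm)
  qed
  have avg: "(\<integral>\<^sup>+\<kappa>. P \<kappa> * g \<kappa> \<partial>count_space C) = (\<integral>\<^sup>+\<omega>. g (\<kappa>0 \<omega>) \<partial>M)" for g
  proof -
    have "(\<integral>\<^sup>+\<omega>. g (\<kappa>0 \<omega>) \<partial>M) = (\<integral>\<^sup>+\<omega>. \<integral>\<^sup>+\<kappa>. ?I \<kappa> \<omega> * g \<kappa> \<partial>count_space C \<partial>M)"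
      by (simp add: select)
    also have "\<dots> = (\<integral>\<^sup>+\<kappa>. \<integral>\<^sup>+\<omega>. ?I \<kappa> \<omega> * g \<kappa> \<partial>M \<partial>count_space C)"
      using C by (rule nn_integral_count_space_nn_integral) measurable
    also have "\<dots> = (\<integral>\<^sup>+\<kappa>. P \<kappa> * g \<kappa> \<partial>count_space C)"
    proof (rule nn_integral_cong)
      fix \<kappa>
      have "(\<integral>\<^sup>+\<omega>. ?I \<kappa> \<omega> \<partial>M) = P \<kappa>"
        unfolding P_def
        by (subst nn_integral_indicator[OF evm, symmetric]) (auto intro!: nn_integral_cong simp: indicator_def)
      then show "(\<integral>\<^sup>+\<omega>. ?I \<kappa> \<omega> * g \<kappa> \<partial>M) = P \<kappa> * g \<kappa>"
        by (simp add: nn_integral_multc)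
    qed
    finally show ?thesis by simp
  qed
  \<comment> \<open>\<open>W\<close> is the error factor, which tends to 1 in mean as \<open>K\<close> grows; \<open>Q\<close> is the main factor.\<close>
  define W where "W K z = ennreal (exp (2 * l / real K * (\<Sum>e\<in>E. \<bar>z (e, False)\<bar>)))"
    for K :: nat and z :: "'e \<times> bool \<Rightarrow> real"
  define Q where "Q \<kappa> z = ennreal (exp (2 * l\<^sup>2 * \<sigma>\<^sup>2 * card (?\<xi> z \<inter> R \<kappa>)))"
    for \<kappa> and z :: "'e \<times> bool \<Rightarrow> real"
  have \<xi>m: "?\<xi> \<in> measurable ?\<Gamma> (count_space UNIV)"
    by (rule argmax_sum_measurable[OF S]) (auto intro: coordinate_measurable[OF \<sigma> E(1)])
  have Wm[measurable]: "W K \<in> borel_measurable ?\<Gamma>" for K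
  proof -
    have [measurable]: "(\<lambda>z. \<Sum>e\<in>E. \<bar>z (e, False)\<bar>) \<in> borel_measurable ?\<Gamma>"
      by (intro borel_measurable_sum borel_measurable_abs coordinate_measurable[OF \<sigma> E(1)])
    show ?thesis unfolding W_def by measurable
  qed
  have Qm[measurable]: "Q \<kappa> \<in> borel_measurable ?\<Gamma>" for \<kappa>
    unfolding Q_def by (rule measurable_compose[OF \<xi>m]) simp
  have resample: "(\<integral>\<^sup>+z. H \<kappa> z \<partial>?\<Gamma>) \<le> (\<integral>\<^sup>+z. W K z * Q \<kappa> z \<partial>?\<Gamma>)" if "K > 0" for K \<kappa>
    using max_sum_resample[OF \<sigma> E(1) _ S l(1) that s, of "R \<kappa>"]
    by (simp add: H_def W_def Q_def R_def exp_add ennreal_mult')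
  have clocks: "(\<integral>\<^sup>+\<omega>. Q (\<kappa>0 \<omega>) z \<partial>M) \<le> ennreal (exp (4 * l\<^sup>2 * p * L))" for z
  proof -
    let ?A = "?\<xi> z"
    define y where "y v = 2 * l\<^sup>2 * (\<sigma>\<^sup>2 * card {e \<in> ?A. block e = v})" for v
    have A: "?A \<in> S" "?A \<subseteq> E" using argmax_sum[OF S(1,2)] S(3) by metis+
    then have fA: "finite ?A" using E finite_subset by blast
    have split: "card (?A \<inter> R \<kappa>) = (\<Sum>v\<in>V. if \<kappa> v \<noteq> 0 then card {e \<in> ?A. block e = v} else 0)" for \<kappa>
    proof -
      have "card (?A \<inter> R \<kappa>) = (\<Sum>v\<in>V. card {e \<in> ?A \<inter> R \<kappa>. block e = v})"
        unfolding card_eq_sum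
        by (rule sum.group[symmetric]) (use fA V A E(3) in auto)
      also have "\<dots> = (\<Sum>v\<in>V. if \<kappa> v \<noteq> 0 then card {e \<in> ?A. block e = v} else 0)"
      proof (rule sum.cong[OF refl])
        fix v
        have "{e \<in> ?A \<inter> R \<kappa>. block e = v} = (if \<kappa> v \<noteq> 0 then {e \<in> ?A. block e = v} else {})"
          using A(2) by (auto simp: R_def)
        then show "card {e \<in> ?A \<inter> R \<kappa>. block e = v} = (if \<kappa> v \<noteq> 0 then card {e \<in> ?A. block e = v} else 0)"
          by simp
      qed
      finally show ?thesis .
    qed
    have "card ?A = (\<Sum>v\<in>V. card {e \<in> ?A. block e = v})"
      unfolding card_eq_sum by (rule sum.group[symmetric]) (use fA V A E(3) in auto)
    then have sy: "(\<Sum>v\<in>V. y v) = 2 * l\<^sup>2 * (\<sigma>\<^sup>2 * card ?A)"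
      by (simp add: y_def sum_distrib_left)
    have y: "0 \<le> y v" "y v \<le> 1" if "v \<in> V" for v
    proof -
      show "0 \<le> y v" by (simp add: y_def)
      have "y v \<le> 1 * 1"
        unfolding y_def using l blk[OF A(1) that] by (intro mult_mono) auto
      then show "y v \<le> 1" by simp
    qed
    have "Q (\<kappa>0 \<omega>) z = ennreal (exp (\<Sum>v\<in>V. if real_of_int (c v \<omega>) \<noteq> 0 then y v else 0))" for \<omega>
      unfolding Q_def split of_nat_sum sum_distrib_left y_def
      by (intro arg_cong[where f = "\<lambda>x. ennreal (exp x)"] sum.cong) (auto simp: \<kappa>0_def)
    then have "(\<integral>\<^sup>+\<omega>. Q (\<kappa>0 \<omega>) z \<partial>M) = (\<integral>\<^sup>+\<omega>. ennreal (exp (\<Sum>v\<in>V. if real_of_int (c v \<omega>) \<noteq> 0 then y v else 0)) \<partial>M)"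
      by simp
    also have "\<dots> \<le> ennreal (exp (2 * p * (\<Sum>v\<in>V. y v)))"
    proof (rule exp_sum_indep_events_le[OF V])
      have "indep_vars (\<lambda>_. borel) (case_sum (\<lambda>v \<omega>. real_of_int (c v \<omega>)) (\<lambda>(e, k). G e k)) (Inl ` V)"
        by (rule indep_vars_subset[OF ind]) auto
      from indep_vars_reindex[OF _ this] show "indep_vars (\<lambda>_. borel) (\<lambda>v \<omega>. real_of_int (c v \<omega>)) V"
        by (simp add: comp_def)
    qed (use p y in auto)
    also have "\<dots> \<le> ennreal (exp (4 * l\<^sup>2 * p * L))"
    proof -
      have "2 * p * (\<Sum>v\<in>V. y v) \<le> 2 * p * (2 * l\<^sup>2 * L)"
        unfolding sy using len[OF A(1)] p0 by (intro mult_left_mono) auto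
      then show ?thesis by (intro ennreal_leI) (simp add: mult_ac)
    qed
    finally show ?thesis .
  qed
  have bound: "(\<integral>\<^sup>+\<omega>. ?F \<omega> \<partial>M) \<le> (\<integral>\<^sup>+z. W K z \<partial>?\<Gamma>) * ennreal (exp (4 * l\<^sup>2 * p * L))"
    if K: "K > 0" for K
  proof -
    have "(\<integral>\<^sup>+\<omega>. ?F \<omega> \<partial>M) = (\<integral>\<^sup>+\<omega>. \<integral>\<^sup>+\<kappa>. ?I \<kappa> \<omega> * H \<kappa> (Z \<kappa> \<omega>) \<partial>count_space C \<partial>M)"
      by (simp add: F select)
    also have "\<dots> = (\<integral>\<^sup>+\<kappa>. \<integral>\<^sup>+\<omega>. ?I \<kappa> \<omega> * H \<kappa> (Z \<kappa> \<omega>) \<partial>M \<partial>count_space C)"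
      using C by (rule nn_integral_count_space_nn_integral) (use HZm in measurable)
    also have "\<dots> = (\<integral>\<^sup>+\<kappa>. P \<kappa> * (\<integral>\<^sup>+z. H \<kappa> z \<partial>?\<Gamma>) \<partial>count_space C)"
      unfolding P_def Z_def
      by (intro nn_integral_cong nn_integral_split_clocks[OF V E(1,2) \<sigma> ind G \<phi> Hm])
    also have "\<dots> \<le> (\<integral>\<^sup>+\<kappa>. P \<kappa> * (\<integral>\<^sup>+z. W K z * Q \<kappa> z \<partial>?\<Gamma>) \<partial>count_space C)"
      by (intro nn_integral_mono mult_left_mono resample K) simp
    also have "\<dots> = (\<integral>\<^sup>+\<kappa>. (\<integral>\<^sup>+z. P \<kappa> * (W K z * Q \<kappa> z) \<partial>?\<Gamma>) \<partial>count_space C)"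
      by (simp add: nn_integral_cmult)
    also have "\<dots> = (\<integral>\<^sup>+z. \<integral>\<^sup>+\<kappa>. P \<kappa> * (W K z * Q \<kappa> z) \<partial>count_space C \<partial>?\<Gamma>)"
      using C by (intro nn_integral_count_space_nn_integral[symmetric]) measurable
    also have "\<dots> = (\<integral>\<^sup>+z. W K z * (\<integral>\<^sup>+\<omega>. Q (\<kappa>0 \<omega>) z \<partial>M) \<partial>?\<Gamma>)"
    proof (rule nn_integral_cong)
      fix z
      have "(\<integral>\<^sup>+\<kappa>. P \<kappa> * (W K z * Q \<kappa> z) \<partial>count_space C) =
          (\<integral>\<^sup>+\<kappa>. W K z * (P \<kappa> * Q \<kappa> z) \<partial>count_space C)"
        by (simp add: mult_ac)
      also have "\<dots> = W K z * (\<integral>\<^sup>+\<kappa>. P \<kappa> * Q \<kappa> z \<partial>count_space C)"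
        by (rule nn_integral_cmult) simp
      finally show "(\<integral>\<^sup>+\<kappa>. P \<kappa> * (W K z * Q \<kappa> z) \<partial>count_space C) =
          W K z * (\<integral>\<^sup>+\<omega>. Q (\<kappa>0 \<omega>) z \<partial>M)"
        by (simp only: avg)
    qed
    also have "\<dots> \<le> (\<integral>\<^sup>+z. W K z * ennreal (exp (4 * l\<^sup>2 * p * L)) \<partial>?\<Gamma>)"
      by (intro nn_integral_mono mult_left_mono clocks) simp
    also have "\<dots> = (\<integral>\<^sup>+z. W K z \<partial>?\<Gamma>) * ennreal (exp (4 * l\<^sup>2 * p * L))"
      by (rule nn_integral_multc) simp
    finally show ?thesis .
  qed
  define C0 where "C0 = enn2real (\<integral>\<^sup>+z. ennreal (exp (\<Sum>e\<in>E. \<bar>z (e, False)\<bar>)) \<partial>?\<Gamma>)"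
  have C0: "(\<integral>\<^sup>+z. ennreal (exp (\<Sum>e\<in>E. \<bar>z (e, False)\<bar>)) \<partial>?\<Gamma>) = ennreal C0" "C0 \<ge> 0"
    using gauss_pairs_exp_abs_sum_finite[OF \<sigma> E(1)] by (auto simp: C0_def)
  interpret N: prob_space "gauss \<sigma>" using prob_space_normal_density[OF \<sigma>] .
  interpret \<Gamma>: prob_space ?\<Gamma> by (intro prob_space_PiM) unfold_locales
  have W: "(\<integral>\<^sup>+z. W K z \<partial>?\<Gamma>) \<le> ennreal (1 + 2 * l / real K * C0)" if K: "real K \<ge> 2 * l" "K > 0" for K
  proof -
    let ?e = "2 * l / real K"
    have e: "0 \<le> ?e" "?e \<le> 1" using K l by auto
    have sm[measurable]: "(\<lambda>z. \<Sum>e\<in>E. \<bar>z (e, False)\<bar>) \<in> borel_measurable ?\<Gamma>"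
      by (intro borel_measurable_sum borel_measurable_abs coordinate_measurable[OF \<sigma> E(1)])
    \<comment> \<open>Convexity of the exponential function on the segment from 0 to \<open>x\<close>.\<close>
    have "ennreal (exp (?e * x)) \<le> 1 + ennreal ?e * ennreal (exp x)" for x :: real
    proof -
      have "exp (1 * ((1 - ?e) *\<^sub>R 0 + ?e *\<^sub>R x)) \<le> (1 - ?e) * exp (1 * 0) + ?e * exp (1 * x)"
        using e by (intro convex_onD[OF convex_on_exp]) auto
      then have "ennreal (exp (?e * x)) \<le> ennreal (1 + ?e * exp x)"
        using e by (intro ennreal_leI) simp
      also have "\<dots> = ennreal 1 + ennreal (?e * exp x)"
        by (rule ennreal_plus) (use l in auto)
      finally show ?thesis using e by (simp flip: ennreal_mult')
    qed
    then have "(\<integral>\<^sup>+z. W K z \<partial>?\<Gamma>) \<le> (\<integral>\<^sup>+z. 1 + ennreal ?e * ennreal (exp (\<Sum>e\<in>E. \<bar>z (e, False)\<bar>)) \<partial>?\<Gamma>)"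
      unfolding W_def by (intro nn_integral_mono)
    also have "\<dots> = 1 + ennreal ?e * ennreal C0"
      using C0 by (subst nn_integral_add) (simp_all add: nn_integral_cmult \<Gamma>.emeasure_space_1)
    also have "\<dots> = ennreal 1 + ennreal (?e * C0)"
      using e by (simp flip: ennreal_mult')
    also have "\<dots> = ennreal (1 + ?e * C0)"
      by (rule ennreal_plus[symmetric]) (use l C0 in auto)
    finally show ?thesis .
  qed
  have "(\<lambda>K. (1 + 2 * l / real K * C0) * exp (4 * l\<^sup>2 * p * L)) \<longlonglongrightarrow> (1 + 0 * C0) * exp (4 * l\<^sup>2 * p * L)"
    by (intro tendsto_intros tendsto_divide_0[OF tendsto_const] filterlim_at_top_imp_at_infinity filterlim_real_sequentially)
  then have "(\<lambda>K. ennreal ((1 + 2 * l / real K * C0) * exp (4 * l\<^sup>2 * p * L))) \<longlonglongrightarrow> ennreal ((1 + 0 * C0) * exp (4 * l\<^sup>2 * p * L))"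
    by (rule tendsto_ennrealI)
  moreover have "\<forall>\<^sub>F K in sequentially. (\<integral>\<^sup>+\<omega>. ?F \<omega> \<partial>M) \<le> ennreal ((1 + 2 * l / real K * C0) * exp (4 * l\<^sup>2 * p * L))"
    using eventually_gt_at_top[of 0] eventually_ge_at_top[of "nat \<lceil>2 * l\<rceil>"]
  proof eventually_elim
    case (elim K)
    then have "real K \<ge> 2 * l" by linarith
    have "(\<integral>\<^sup>+\<omega>. ?F \<omega> \<partial>M) \<le> ennreal (1 + 2 * l / real K * C0) * ennreal (exp (4 * l\<^sup>2 * p * L))"
      using bound[OF elim(1)] mult_right_mono[OF W[OF \<open>real K \<ge> 2 * l\<close> elim(1)]] order_trans by fastforce
    then show ?case by (simp add: ennreal_mult'')
  qed
  ultimately show ?thesis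
    using tendsto_lowerbound[OF _ _ sequentially_bot] by fastforce
qed

section \<open>Clocks and increments of the dynamical model\<close>

context dynamical_blpp
begin

text \<open>Cell \<open>(q, j)\<close> is the interval \<open>[q/m, (q+1)/m]\<close> of row \<open>j\<close>. It is the part number \<open>q mod m\<close> of
  the block \<open>(q div m, j)\<close>; the index \<open>k\<close> is the number of the path that is installed there.\<close>

definition cell_increment :: "nat \<Rightarrow> nat \<times> int \<Rightarrow> int \<Rightarrow> 'a \<Rightarrow> real" where
  "cell_increment m = (\<lambda>(q, j) k \<omega>.
     B (int (q div m)) j k (real (Suc (q mod m)) / real m) \<omega> - B (int (q div m)) j k (real (q mod m) / real m) \<omega>)"

lemma distr_cell_increment:
  assumes m: "m > 0"
  shows "distr M borel (cell_increment m e k) = gauss (sqrt (1 / m))"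
proof -
  obtain q j where e: "e = (q, j)" by force
  define r where "r = q mod m"
  have "r < m" using m by (simp add: r_def)
  then have r: "0 \<le> real r / m" "real r / m < Suc r / m" "Suc r / m \<le> 1" "real (Suc r) / m - r / m = 1 / m"
    using m by (auto simp: field_simps)
  have "distributed M lborel (cell_increment m e k) (normal_density 0 (sqrt (1 / m)))"
  proof -
    have "distributed M lborel (\<lambda>\<omega>. B (int (q div m)) j k (real (Suc r) / m) \<omega> - B (int (q div m)) j k (real r / m) \<omega>)
        (normal_density 0 (sqrt (real (Suc r) / m - real r / m)))"
      using path[of "int (q div m)" j k] r(1-3) unfolding brownian_motion_01_def by blast
    then show ?thesis
      unfolding r(4) by (simp add: cell_increment_def e r_def)
  qed
  then have "distr M lborel (cell_increment m e k) = gauss (sqrt (1 / m))"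
    by (simp add: distributed_def)
  moreover have "distr M lborel (cell_increment m e k) = distr M borel (cell_increment m e k)"
    by (rule distr_cong) auto
  ultimately show ?thesis by simp
qed

text \<open>The probability is \<open>1 - exp (- t)\<close>.\<close>

lemma prob_ring_le:
  assumes t: "t \<ge> 0"
  shows "\<P>(\<omega> in M. N i j t \<omega> \<noteq> 0) \<le> t"
proof (cases "t = 0")
  case True
  have *: "{\<omega> \<in> space M. N i j t \<omega> \<noteq> 0} = {}"
    using clock[of i j] True by (auto simp: poisson_clock_def)
  show ?thesis unfolding * using t by simp
next
  case False
  with t have t: "t > 0" by simp
  let ?X = "\<lambda>\<omega>. nat (N i j t \<omega> - N i j 0 \<omega>)"
  have N: "N i j s \<in> measurable M (count_space UNIV)" for s
    using clock[of i j] by (auto simp: poisson_clock_def)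
  have "?X \<in> measurable M (count_space UNIV) \<longleftrightarrow> (\<lambda>\<omega>. nat (N i j t \<omega>)) \<in> measurable M (count_space UNIV)"
    by (rule measurable_cong) (use clock[of i j] in \<open>auto simp: poisson_clock_def\<close>)
  then have [measurable]: "?X \<in> measurable M (count_space UNIV)"
    using measurable_compose[OF N[of t], of nat "count_space UNIV"] by simp
  have D: "distr M (count_space UNIV) ?X = measure_pmf (poisson_pmf t)"
    using clock[of i j] t by (auto simp: poisson_clock_def)
  have "{\<omega> \<in> space M. N i j t \<omega> \<noteq> 0} = space M - ?X -` {0} \<inter> space M"
  proof -
    have "N i j 0 \<omega> = 0" "N i j 0 \<omega> \<le> N i j t \<omega>" if "\<omega> \<in> space M" for \<omega>
      using clock[of i j] that t monoD[of "\<lambda>s. N i j s \<omega>" 0 t] by (auto simp: poisson_clock_def)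
    then show ?thesis by force
  qed
  then have "\<P>(\<omega> in M. N i j t \<omega> \<noteq> 0) = 1 - prob (?X -` {0} \<inter> space M)"
    by (simp add: prob_compl)
  also have "prob (?X -` {0} \<inter> space M) = measure (distr M (count_space UNIV) ?X) {0}"
    by (subst measure_distr) auto
  also have "\<dots> = exp (- t)"
    unfolding D using t by (simp add: measure_pmf_single)
  also have "1 - exp (- t) \<le> t"
    using exp_ge_add_one_self[of "- t"] by simp
  finally show ?thesis .
qed

lemma process_events_sigma_algebra: "sigma_algebra (space M) (process_events M S I Y)"
  unfolding process_events_def by (rule sigma_algebra_sigma_sets) auto

text \<open>Different clocks and paths are independent by assumption, and within one path the increments
  over disjoint cells are independent.\<close>

lemma indep_clocks_cell_increments:
  assumes m: "m > 0"
  shows "indep_vars (\<lambda>_. borel)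
    (case_sum (\<lambda>v \<omega>. real_of_int (case_prod N v t \<omega>)) (\<lambda>(e, k). cell_increment m e k)) T"
proof -
  define Y :: "int \<times> int + int \<times> int \<times> int \<Rightarrow> nat \<Rightarrow> 'a \<Rightarrow> real" where
    "Y = case_sum (\<lambda>(i, j) r \<omega>. real_of_int (N i j t \<omega>))
       (\<lambda>(i, j, k) r \<omega>. B i j k (Suc r / m) \<omega> - B i j k (r / m) \<omega>)"
  define J where "J = case_sum (\<lambda>_ :: int \<times> int. {0::nat}) (\<lambda>_ :: int \<times> int \<times> int. {..<m})"
  define G where "G a r = {Y a r -` A \<inter> space M | A. A \<in> sets borel}" for a r
  let ?F = "case_sum (\<lambda>(i, j). process_events M (count_space UNIV) UNIV (N i j))
           (\<lambda>(i, j, k). process_events M borel {0..1} (B i j k))"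
  have Nm: "N i j t \<in> measurable M (count_space UNIV)" for i j
    using clock[of i j] by (auto simp: poisson_clock_def)
  have Bm: "B i j k u \<in> borel_measurable M" if "u \<in> {0..1}" for i j k u
    using path[of i j k] that by (auto simp: brownian_motion_01_def)
  have grid: "real r / m \<in> {0..1}" "real (Suc r) / m \<in> {0..1}" if "r < m" for r
    using that by (auto simp: field_simps)
  have Ym: "Y a r \<in> borel_measurable M" if r: "r \<in> J a" for a r
  proof (cases a)
    case (Inl v)
    then show ?thesis
      using measurable_compose[OF Nm, of real_of_int borel] by (cases v) (simp add: Y_def)
  next
    case (Inr w)
    then show ?thesis
      using grid Bm r by (cases w) (auto simp: Y_def J_def intro!: borel_measurable_diff simp del: of_nat_Suc)
  qed
  have "indep_sets (\<lambda>(a, r). G a r) (Sigma UNIV J)"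
  proof (rule indep_sets_nested[OF independent])
    fix a :: "int \<times> int + int \<times> int \<times> int"
    show "sigma_algebra (space M) (?F a)"
      by (cases a) (auto simp: process_events_sigma_algebra)
    show "indep_sets (G a) (J a)"
    proof (cases a)
      case (Inl v)
      have "G a 0 \<subseteq> events" using Ym[of 0 a] Inl by (auto simp: G_def J_def measurable_sets)
      then show ?thesis using Inl indep_sets_singleton[of "G a" 0] by (simp add: J_def)
    next
      case (Inr w)
      obtain i j k where w: "w = (i, j, k)" by (cases w)
      have inc: "independent_increments M borel {0..1} (B i j k)"
        using path[of i j k] by (simp add: brownian_motion_01_def)
      have "strict_mono_on {..m} (\<lambda>r. real r / m)" "(\<lambda>r. real r / m) ` {..m} \<subseteq> {0..1}"
        using m by (auto simp: strict_mono_on_def divide_strict_right_mono field_simps)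
      with inc have "indep_vars (\<lambda>_. borel) (\<lambda>r \<omega>. B i j k (real (Suc r) / m) \<omega> - B i j k (real r / m) \<omega>) {..<m}"
        unfolding independent_increments_def by blast
      then show ?thesis
        unfolding indep_vars_def2 by (simp add: Inr w J_def G_def[abs_def] Y_def)
    qed
    fix r assume r: "r \<in> J a"
    show "G a r \<subseteq> ?F a"
    proof (cases a)
      case (Inl v)
      obtain i j where v: "v = (i, j)" by (cases v)
      have "Y a r -` A = N i j t -` (real_of_int -` A)" for A
        by (auto simp: Y_def Inl v)
      then show ?thesis
        unfolding G_def Inl v process_events_def by (auto intro!: sigma_sets.Basic simp: Inl v)
    next
      case (Inr w)
      obtain i j k where w: "w = (i, j, k)" by (cases w)
      let ?gen = "{B i j k s -` A \<inter> space M | s A. s \<in> {0..1} \<and> A \<in> sets borel}"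
      let ?P = "sigma (space M) ?gen"
      have gen: "?gen \<subseteq> Pow (space M)" by auto
      have BP: "B i j k u \<in> borel_measurable ?P" if "u \<in> {0..1}" for u
        using that gen by (intro measurableI) (auto simp: space_measure_of_conv intro!: sigma_sets.Basic)
      have "Y a r \<in> borel_measurable ?P"
        using grid BP r by (auto simp: Y_def J_def Inr w intro!: borel_measurable_diff simp del: of_nat_Suc)
      then have "Y a r -` A \<inter> space M \<in> sigma_sets (space M) ?gen" if "A \<in> sets borel" for A
        using measurable_sets[of "Y a r" ?P borel A] that gen by (simp add: space_measure_of_conv)
      then show ?thesis
        unfolding G_def Inr w process_events_def by (auto simp: Inr w)
    qed
  qed
  then have Y: "indep_vars (\<lambda>_. borel) (\<lambda>(a, r). Y a r) (Sigma UNIV J)"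
  proof -
    have "(\<lambda>p. {(\<lambda>(a, r). Y a r) p -` A \<inter> space M | A. A \<in> sets borel}) = (\<lambda>(a, r). G a r)"
      by (auto simp: G_def fun_eq_iff)
    then show ?thesis
      unfolding indep_vars_def2 using Ym \<open>indep_sets _ (Sigma UNIV J)\<close> by auto
  qed
  define f :: "int \<times> int + (nat \<times> int) \<times> int \<Rightarrow> (int \<times> int + int \<times> int \<times> int) \<times> nat" where
    "f = case_sum (\<lambda>v. (Inl v, 0)) (\<lambda>((q, j), k). (Inr (int (q div m), j, k), q mod m))"
  have f: "inj f"
  proof (rule injI)
    fix x y assume eq: "f x = f y"
    show "x = y"
    proof (cases x)
      case (Inl v)
      then show ?thesis using eq by (cases y) (auto simp: f_def)
    next
      case (Inr w)
      obtain q j k where w: "w = ((q, j), k)" by (metis prod.exhaust)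
      obtain q' j' k' where y: "y = Inr ((q', j'), k')"
        using eq Inr w by (cases y) (auto simp: f_def)
      have "q div m = q' div m" "q mod m = q' mod m" "j = j'" "k = k'"
        using eq by (simp_all add: f_def Inr w y)
      moreover from this have "q = q'" by (metis div_mult_mod_eq)
      ultimately show ?thesis by (simp add: Inr w y)
    qed
  qed
  have "f ` T \<subseteq> Sigma UNIV J"
    using m by (auto simp: f_def J_def split: sum.splits prod.splits)
  from indep_vars_reindex[OF inj_on_subset[OF f subset_UNIV] indep_vars_subset[OF Y this]]
  have "indep_vars (\<lambda>_. borel) (\<lambda>x. (\<lambda>(a, r). Y a r) (f x)) T" .
  also have "(\<lambda>x. (\<lambda>(a, r). Y a r) (f x)) =
      case_sum (\<lambda>v \<omega>. real_of_int (case_prod N v t \<omega>)) (\<lambda>(e, k). cell_increment m e k)"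
    by (auto simp: fun_eq_iff f_def Y_def cell_increment_def split: sum.splits prod.splits)
  finally show ?thesis .
qed

end

section \<open>Discretisation of the staircases\<close>

lemma continuous_on_row_path:
  assumes 0: "\<And>i. X i j 0 = 0" and cont: "\<And>i. continuous_on {0..1} (X i j)"
  shows "continuous_on {0..real n} (row_path X j)"
proof (induction n)
  case (Suc n)
  have "continuous_on {real n..real (Suc n)} (\<lambda>x. row_path X j (real n) + X (int n) j (x - real n))"
    by (intro continuous_intros continuous_on_compose2[OF cont]) auto
  then have "continuous_on {real n..real (Suc n)} (row_path X j)"
  proof (rule continuous_on_eq)
    fix x assume "x \<in> {real n..real (Suc n)}"
    then show "row_path X j (real n) + X (int n) j (x - real n) = row_path X j x"
      using row_path_increment[of X j "x - real n" "int n", OF 0] by simp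
  qed
  moreover have "{0..real (Suc n)} = {0..real n} \<union> {real n..real (Suc n)}" by auto
  ultimately show ?case
    using Suc continuous_on_closed_Un[of "{0..real n}" "{real n..real (Suc n)}"] by simp
qed simp

lemma row_path_cell_increment:
  assumes 0: "\<And>i. X i j 0 = 0" and m: "m > 0"
  shows "row_path X j (real (Suc q) / real m) - row_path X j (real q / real m) =
    X (int (q div m)) j (real (Suc (q mod m)) / real m) - X (int (q div m)) j (real (q mod m) / real m)"
proof -
  have q: "real q = real m * real (q div m) + real (q mod m)"
    by (metis mult_div_mod_eq of_nat_add of_nat_mult)
  have "q mod m < m" using m by simp
  then have "real (Suc (q mod m)) \<le> real m" by (intro of_nat_mono) simp
  then have r: "0 \<le> real (q mod m) / m" "real (q mod m) / m \<le> 1" "real (Suc (q mod m)) / m \<le> 1"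
      "0 \<le> real (Suc (q mod m)) / m"
    using m by (auto simp: field_simps)
  have "real q / m = of_int (int (q div m)) + real (q mod m) / m"
    "real (Suc q) / m = of_int (int (q div m)) + real (Suc (q mod m)) / m"
    using m by (simp_all add: q field_simps)
  then show ?thesis
    using row_path_increment[of X j "real (q mod m) / m" "int (q div m)", OF 0]
      row_path_increment[of X j "real (Suc (q mod m)) / m" "int (q div m)", OF 0] r by simp
qed

lemma step_mono_int:
  fixes f :: "int \<Rightarrow> 'b::linorder"
  assumes step: "\<forall>j\<in>{0..n}. f (j - 1) \<le> f j" and ij: "-1 \<le> i" "i \<le> j" "j \<le> n"
  shows "f i \<le> f j"
  using ij(2,3)
proof (induction j rule: int_ge_induct)
  case (step j)
  then have "f i \<le> f j" by simp
  also have "f (j + 1 - 1) \<le> f (j + 1)"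
    using step ij by (intro bspec[OF assms(1)]) auto
  then have "f j \<le> f (j + 1)" by simp
  finally show ?case .
qed simp

lemma sum_telescope_int: "(\<Sum>j\<in>{0..int n}. g j - g (j - 1)) = g (int n) - (g (-1) :: 'b::ab_group_add)"
proof (induction n)
  case (Suc n)
  have "{0..int (Suc n)} = insert (int n + 1) {0..int n}" by auto
  then show ?case using Suc by (simp add: add.commute)
qed simp

text \<open>A staircase with corners on the grid of mesh \<open>1/m\<close>, given by its corners multiplied by \<open>m\<close>.\<close>

definition grid_steps :: "nat \<Rightarrow> nat \<Rightarrow> (int \<Rightarrow> nat) set" where
  "grid_steps n m = {z. z (-1) = 0 \<and> z (int n) = n * m \<and> (\<forall>j\<in>{0..int n}. z (j - 1) \<le> z j)}"

definition cells :: "nat \<Rightarrow> (int \<Rightarrow> nat) \<Rightarrow> (nat \<times> int) set" where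
  "cells n z = {(q, j). j \<in> {0..int n} \<and> z (j - 1) \<le> q \<and> q < z j}"

definition grid_staircases :: "nat \<Rightarrow> nat \<Rightarrow> (nat \<times> int) set set" where
  "grid_staircases n m = cells n ` grid_steps n m"

lemma grid_staircases_subset:
  assumes "A \<in> grid_staircases n m"
  shows "A \<subseteq> {..<n * m} \<times> {0..int n}"
proof -
  obtain z where z: "z \<in> grid_steps n m" and A: "A = cells n z"
    using assms by (auto simp: grid_staircases_def)
  have "z j \<le> n * m" if "j \<in> {0..int n}" for j
    using step_mono_int[of "int n" z j "int n"] z that by (auto simp: grid_steps_def)
  then show ?thesis
    unfolding A cells_def by (auto intro: less_le_trans)
qed

lemma finite_grid_staircases: "finite (grid_staircases n m)"
proof (rule finite_subset)
  show "grid_staircases n m \<subseteq> Pow ({..<n * m} \<times> {0..int n})"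
    using grid_staircases_subset by blast
qed simp

lemma grid_staircases_nonempty: "grid_staircases n m \<noteq> {}"
proof -
  have "(\<lambda>j. if j = int n then n * m else 0) \<in> grid_steps n m"
    by (auto simp: grid_steps_def)
  then show ?thesis by (auto simp: grid_staircases_def)
qed

lemma sum_cells:
  "(\<Sum>e\<in>cells n z. g e) = (\<Sum>j\<in>{0..int n}. \<Sum>q\<in>{z (j - 1)..<z j}. g (q, j))"
proof -
  have "(\<Sum>e\<in>cells n z. g e) = (\<Sum>(j, q)\<in>Sigma {0..int n} (\<lambda>j. {z (j - 1)..<z j}). g (q, j))"
    by (rule sum.reindex_bij_witness[where i = prod.swap and j = prod.swap]) (auto simp: cells_def)
  also have "\<dots> = (\<Sum>j\<in>{0..int n}. \<Sum>q\<in>{z (j - 1)..<z j}. g (q, j))"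
    by (rule sum.Sigma[symmetric]) auto
  finally show ?thesis .
qed

lemma card_grid_staircase:
  assumes "A \<in> grid_staircases n m"
  shows "card A = n * m"
proof -
  obtain z where z: "z \<in> grid_steps n m" and A: "A = cells n z"
    using assms by (auto simp: grid_staircases_def)
  have "int (card A) = (\<Sum>e\<in>cells n z. 1)" by (simp add: A)
  also have "\<dots> = (\<Sum>j\<in>{0..int n}. int (z j) - int (z (j - 1)))"
    unfolding sum_cells using z by (intro sum.cong) (auto simp: grid_steps_def of_nat_diff)
  also have "\<dots> = int (n * m)"
    using sum_telescope_int[of "\<lambda>j. int (z j)" n] z by (simp add: grid_steps_def)
  finally show ?thesis by linarith
qed

text \<open>A block contains only \<open>m\<close> cells, so a staircase has length at most \<open>1\<close> in it.\<close>

lemma card_cells_in_block: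
  assumes m: "m > 0"
  shows "card {e \<in> A. (int (fst e div m), snd e) = v} \<le> m"
proof -
  obtain i j where v: "v = (i, j)" by force
  have "{e \<in> A. (int (fst e div m), snd e) = v} \<subseteq> (\<lambda>r. (m * nat i + r, j)) ` {..<m}"
  proof (rule subsetI)
    fix e assume e: "e \<in> {e \<in> A. (int (fst e div m), snd e) = v}"
    obtain q k where qk: "e = (q, k)" by force
    have "e = (\<lambda>r. (m * nat i + r, j)) (q mod m)" using e by (auto simp: v qk)
    then show "e \<in> (\<lambda>r. (m * nat i + r, j)) ` {..<m}"
      by (rule image_eqI) (use m in simp)
  qed
  from card_mono[OF _ this] card_image_le[of "{..<m}" "\<lambda>r. (m * nat i + r, j)"] show ?thesis by simp
qed

text \<open>The increments telescope along each row.\<close>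

lemma sum_grid_staircase:
  assumes "z \<in> grid_steps n m"
  shows "(\<Sum>e\<in>cells n z. W (snd e) (real (Suc (fst e)) / m) - W (snd e) (real (fst e) / m)) =
    staircase_weight W (0, 0) (real n, int n) (\<lambda>j. real (z j) / m)"
proof -
  have "(\<Sum>q\<in>{a..<b}. W j (real (Suc q) / m) - W j (real q / m)) = W j (real b / m) - W j (real a / m)"
    if "a \<le> b" for a b j
    using sum_Suc_diff'[OF that, of "\<lambda>q. W j (real q / m)"] by simp
  then show ?thesis
    using assms unfolding sum_cells staircase_weight_def by (intro sum.cong) (auto simp: grid_steps_def)
qed

lemma grid_staircase:
  assumes "z \<in> grid_steps n m" "m > 0"
  shows "staircase (0, 0) (real n, int n) (\<lambda>j. real (z j) / m)"
  unfolding staircase_def fst_conv snd_conv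
  using assms by (intro conjI ballI divide_right_mono) (simp_all add: grid_steps_def)

lemma round_down_grid_steps:
  assumes \<xi>: "staircase (0, 0) (real n, int n) \<xi>"
  shows "(\<lambda>j. nat \<lfloor>real m * \<xi> j\<rfloor>) \<in> grid_steps n m"
proof -
  have "real m * real n = of_int (int (n * m))" by simp
  then have "nat \<lfloor>real m * real n\<rfloor> = n * m" by (simp only: floor_of_int nat_int)
  then show ?thesis
    using \<xi> by (auto simp: staircase_def grid_steps_def intro!: nat_mono floor_mono mult_left_mono)
qed

lemma staircase_range:
  assumes \<xi>: "staircase (0, 0) (real n, int n) \<xi>" and j: "-1 \<le> j" "j \<le> int n"
  shows "\<xi> j \<in> {0..real n}"
proof -
  have steps: "\<forall>j\<in>{0..int n}. \<xi> (j - 1) \<le> \<xi> j" and ends: "\<xi> (-1) = 0" "\<xi> (int n) = real n"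
    using \<xi> by (simp_all add: staircase_def)
  have "\<xi> (-1) \<le> \<xi> j" "\<xi> j \<le> \<xi> (int n)"
    by (rule step_mono_int[OF steps], use j in simp, use j in simp, use j in simp)+
  then show ?thesis by (simp add: ends)
qed

lemma round_down_tendsto:
  assumes "x \<ge> 0"
  shows "(\<lambda>m. real (nat \<lfloor>real m * x\<rfloor>) / real m) \<longlonglongrightarrow> x"
proof (rule real_tendsto_sandwich[where f = "\<lambda>m. x - 1 / real m" and h = "\<lambda>_. x"])
  have *: "real (nat \<lfloor>real m * x\<rfloor>) = of_int \<lfloor>real m * x\<rfloor>" for m
    using assms by simp
  show "\<forall>\<^sub>F m in sequentially. x - 1 / real m \<le> real (nat \<lfloor>real m * x\<rfloor>) / real m"
    using eventually_gt_at_top[of 0]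
  proof eventually_elim
    case (elim m)
    have "real m * x - 1 \<le> of_int \<lfloor>real m * x\<rfloor>" by linarith
    then have "(real m * x - 1) / real m \<le> of_int \<lfloor>real m * x\<rfloor> / real m"
      by (rule divide_right_mono) simp
    then show ?case using elim unfolding * by (simp add: diff_divide_distrib)
  qed
  show "\<forall>\<^sub>F m in sequentially. real (nat \<lfloor>real m * x\<rfloor>) / real m \<le> x"
    using eventually_gt_at_top[of 0]
  proof eventually_elim
    case (elim m)
    have "of_int \<lfloor>real m * x\<rfloor> \<le> real m * x" by linarith
    then show ?case using elim unfolding * by (simp add: field_simps)
  qed
  show "(\<lambda>m. x - 1 / real m) \<longlonglongrightarrow> x"
    using tendsto_diff[OF tendsto_const[of x] lim_1_over_n] by simp
qed simp

lemma staircase_weights_bdd_above: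
  assumes cont: "\<And>j. j \<in> {0..int n} \<Longrightarrow> continuous_on {0..real n} (W j)"
  shows "bdd_above (staircase_weight W (0, 0) (real n, int n) ` {\<xi>. staircase (0, 0) (real n, int n) \<xi>})"
proof -
  have "\<exists>b. \<forall>x\<in>{0..real n}. \<bar>W j x\<bar> \<le> b" if "j \<in> {0..int n}" for j
    using compact_imp_bounded[OF compact_continuous_image[OF cont[OF that] compact_Icc]]
    by (auto simp: bounded_iff)
  then obtain b where b: "\<bar>W j x\<bar> \<le> b j" if "j \<in> {0..int n}" "x \<in> {0..real n}" for j x
    by metis
  show ?thesis
  proof (rule bdd_aboveI2)
    fix \<xi> assume "\<xi> \<in> {\<xi>. staircase (0, 0) (real n, int n) \<xi>}"
    then have \<xi>: "staircase (0, 0) (real n, int n) \<xi>" by simp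
    show "staircase_weight W (0, 0) (real n, int n) \<xi> \<le> (\<Sum>j\<in>{0..int n}. 2 * b j)"
      unfolding staircase_weight_def fst_conv snd_conv
    proof (rule sum_mono)
      fix j assume j: "j \<in> {0..int n}"
      then show "W j (\<xi> j) - W j (\<xi> (j - 1)) \<le> 2 * b j"
        using b[OF j staircase_range[OF \<xi>, of j]] b[OF j staircase_range[OF \<xi>, of "j - 1"]] by auto
    qed
  qed
qed

text \<open>Grid staircases are staircases, which gives one inequality for every mesh. Conversely, rounding
  the corners of a nearly optimal staircase down to the grid preserves its order and its integer end
  points, and by continuity of the rows its weight changes little.\<close>

lemma grid_passage_time_tendsto:
  assumes cont: "\<And>j. j \<in> {0..int n} \<Longrightarrow> continuous_on {0..real n} (W j)"
  shows "(\<lambda>m. max_sum (grid_staircases n m)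
      (\<lambda>e. W (snd e) (real (Suc (fst e)) / m) - W (snd e) (real (fst e) / m)))
    \<longlonglongrightarrow> passage_time W (0, 0) (real n, int n)"
    (is "?T \<longlonglongrightarrow> ?P")
proof (rule LIMSEQ_I)
  let ?w = "staircase_weight W (0, 0) (real n, int n)"
  let ?st = "{\<xi>. staircase (0, 0) (real n, int n) \<xi>}"
  have bdd: "bdd_above (?w ` ?st)"
    using cont by (rule staircase_weights_bdd_above)
  fix \<epsilon> :: real assume \<epsilon>: "\<epsilon> > 0"
  have upper: "?T m \<le> ?P" if m: "m > 0" for m
  proof -
    let ?x = "\<lambda>e. W (snd e) (real (Suc (fst e)) / m) - W (snd e) (real (fst e) / m)"
    note argmax = argmax_sum[of "grid_staircases n m" ?x, OF finite_grid_staircases grid_staircases_nonempty]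
    obtain z where z1: "z \<in> grid_steps n m" and A: "argmax_sum (grid_staircases n m) ?x = cells n z"
      using argmax(1) by (auto simp: grid_staircases_def)
    have z2: "?T m = ?w (\<lambda>j. real (z j) / m)"
      unfolding argmax(2)[symmetric] A by (rule sum_grid_staircase[OF z1])
    show ?thesis
      unfolding z2 passage_time_def using grid_staircase[OF z1 m] bdd by (intro cSUP_upper) auto
  qed
  have st: "?st \<noteq> {}"
  proof -
    obtain z where "z \<in> grid_steps n 1"
      using grid_staircases_nonempty[of n 1] by (auto simp: grid_staircases_def)
    from grid_staircase[OF this] show ?thesis by auto
  qed
  have "?P - \<epsilon> < (SUP \<xi>\<in>?st. ?w \<xi>)"
    using \<epsilon> by (simp add: passage_time_def)
  then obtain \<xi> where \<xi>: "staircase (0, 0) (real n, int n) \<xi>" and w\<xi>: "?P - \<epsilon> < ?w \<xi>"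
    unfolding less_cSUP_iff[OF st bdd] by auto
  let ?z = "\<lambda>m j. nat \<lfloor>real m * \<xi> j\<rfloor>"
  have lower: "?w (\<lambda>j. real (?z m j) / m) \<le> ?T m" for m
    unfolding sum_grid_staircase[OF round_down_grid_steps[OF \<xi>], symmetric]
  proof (rule sum_le_max_sum[OF finite_grid_staircases])
    show "cells n (?z m) \<in> grid_staircases n m"
      unfolding grid_staircases_def using round_down_grid_steps[OF \<xi>] by (rule imageI)
  qed
  have "(\<lambda>m. W j (real (?z m k) / m)) \<longlonglongrightarrow> W j (\<xi> k)" if j: "j \<in> {0..int n}" and k: "-1 \<le> k" "k \<le> int n" for j k
  proof (rule continuous_on_tendsto_compose[OF cont[OF j]])
    show "\<xi> k \<in> {0..real n}" by (rule staircase_range[OF \<xi> k])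
    then show "(\<lambda>m. real (?z m k) / real m) \<longlonglongrightarrow> \<xi> k" by (intro round_down_tendsto) simp
    show "\<forall>\<^sub>F m in sequentially. real (?z m k) / real m \<in> {0..real n}"
      using eventually_gt_at_top[of 0]
    proof eventually_elim
      case (elim m)
      from staircase_range[OF grid_staircase[OF round_down_grid_steps[OF \<xi>] elim] k] show ?case .
    qed
  qed
  then have "(\<lambda>m. ?w (\<lambda>j. real (?z m j) / m)) \<longlonglongrightarrow> ?w \<xi>"
    unfolding staircase_weight_def fst_conv snd_conv by (intro tendsto_sum tendsto_diff) auto
  from order_tendstoD(1)[OF this w\<xi>] have "\<forall>\<^sub>F m in sequentially. norm (?T m - ?P) < \<epsilon>"
    using eventually_gt_at_top[of 0]
  proof eventually_elim
    case (elim m)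
    then show ?case using lower[of m] upper[of m] \<epsilon> by (auto simp: abs_less_iff)
  qed
  then show "\<exists>no. \<forall>m\<ge>no. norm (?T m - ?P) < \<epsilon>" by (simp add: eventually_sequentially)
qed

section \<open>The tail estimate\<close>

context dynamical_blpp
begin

lemma block_path_0: "\<omega> \<in> space M \<Longrightarrow> block_path N B t \<omega> i j 0 = 0"
  using path by (auto simp: block_path_def brownian_motion_01_def)

lemma block_path_continuous: "\<omega> \<in> space M \<Longrightarrow> continuous_on {0..1} (block_path N B t \<omega> i j)"
  using path by (auto simp: block_path_def[abs_def] brownian_motion_01_def)

text \<open>The passage time when only staircases on the grid of mesh \<open>1/m\<close> compete.\<close>

definition grid_time :: "nat \<Rightarrow> nat \<Rightarrow> real \<Rightarrow> 'a \<Rightarrow> real" where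
  "grid_time n m t \<omega> = max_sum (grid_staircases n m)
     (\<lambda>e. cell_increment m e (N (int (fst e div m)) (snd e) t \<omega>) \<omega>)"

lemma grid_time_tendsto:
  assumes \<omega>: "\<omega> \<in> space M"
  shows "(\<lambda>m. grid_time n m t \<omega>) \<longlonglongrightarrow> dynamical_passage_time N B (0, 0) (real n, int n) t \<omega>"
proof -
  let ?X = "block_path N B t \<omega>"
  have "(\<lambda>m. max_sum (grid_staircases n m)
      (\<lambda>e. row_path ?X (snd e) (real (Suc (fst e)) / m) - row_path ?X (snd e) (real (fst e) / m)))
    \<longlonglongrightarrow> dynamical_passage_time N B (0, 0) (real n, int n) t \<omega>"
    unfolding dynamical_passage_time_def
    by (intro grid_passage_time_tendsto continuous_on_row_path block_path_0[OF \<omega>] block_path_continuous[OF \<omega>])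
  moreover have "\<forall>\<^sub>F m in sequentially. max_sum (grid_staircases n m)
      (\<lambda>e. row_path ?X (snd e) (real (Suc (fst e)) / m) - row_path ?X (snd e) (real (fst e) / m)) = grid_time n m t \<omega>"
    using eventually_gt_at_top[of 0]
  proof eventually_elim
    case (elim m)
    have "row_path ?X (snd e) (real (Suc (fst e)) / m) - row_path ?X (snd e) (real (fst e) / m) =
        cell_increment m e (N (int (fst e div m)) (snd e) t \<omega>) \<omega>" for e
      using row_path_cell_increment[of ?X "snd e" m "fst e"] block_path_0[OF \<omega>] elim
      by (simp add: cell_increment_def block_path_def split_beta)
    then show ?case by (simp add: grid_time_def)
  qed
  ultimately show ?thesis by (rule Lim_transform_eventually)
qed

lemma cell_increment_measurable: "m > 0 \<Longrightarrow> cell_increment m e k \<in> borel_measurable M"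
  using indep_clocks_cell_increments[of m 0 "{Inr (e, k)}"] by (simp add: indep_vars_def)

lemma N_measurable [measurable]: "N i j t \<in> measurable M (count_space UNIV)"
  using clock[of i j] by (simp add: poisson_clock_def)

lemma grid_time_measurable:
  assumes m: "m > 0"
  shows "grid_time n m t \<in> borel_measurable M"
  unfolding grid_time_def
proof (rule max_sum_measurable[OF finite_grid_staircases grid_staircases_nonempty grid_staircases_subset])
  fix e :: "nat \<times> int"
  show "(\<lambda>\<omega>. cell_increment m e (N (int (fst e div m)) (snd e) t \<omega>) \<omega>) \<in> borel_measurable M"
    by (rule measurable_compose_countable[OF cell_increment_measurable[OF m] N_measurable])
qed

lemma exp_grid_time_difference:
  assumes n: "n \<ge> 1" and m: "m > 0" and t: "t \<ge> 0" and l: "l \<ge> 0" "2 * l\<^sup>2 \<le> 1" and s: "s = 1 \<or> s = -1"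
  shows "(\<integral>\<^sup>+\<omega>. ennreal (exp (s * l * (grid_time n m t \<omega> - grid_time n m 0 \<omega>))) \<partial>M)
    \<le> ennreal (exp (4 * l\<^sup>2 * t * real n))"
proof -
  let ?V = "{0..<int n} \<times> {0..int n}" and ?E = "{..<n * m} \<times> {0..int n}"
  let ?block = "\<lambda>e. (int (fst e div m), snd e)"
  let ?S = "grid_staircases n m"
  let ?\<sigma> = "sqrt (1 / real m)"
  have \<sigma>2: "?\<sigma>\<^sup>2 = 1 / real m" by simp
  have "(0, 0) \<in> ?E" using n m by simp
  then have E: "?E \<noteq> {}" by blast
  have block: "?block ` ?E \<subseteq> ?V"
    by (auto simp: less_mult_imp_div_less)
  have "(\<integral>\<^sup>+\<omega>. ennreal (exp (s * l * (max_sum ?S (\<lambda>e. cell_increment m e (case_prod N (?block e) t \<omega>) \<omega>)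
       - max_sum ?S (\<lambda>e. cell_increment m e 0 \<omega>)))) \<partial>M) \<le> ennreal (exp (4 * l\<^sup>2 * t * real n))"
  proof (rule exp_max_sum_resample_clocks[where V = ?V and E = ?E and \<sigma> = ?\<sigma> and c = "\<lambda>v. case_prod N v t"])
    show "\<P>(\<omega> in M. case_prod N v t \<omega> \<noteq> 0) \<le> t" for v
      using prob_ring_le[OF t] by (cases v) simp
    show "?\<sigma>\<^sup>2 * real (card A) \<le> real n" if "A \<in> ?S" for A
      unfolding \<sigma>2 using m card_grid_staircase[OF that] by simp
    show "?\<sigma>\<^sup>2 * real (card {e \<in> A. ?block e = v}) \<le> 1" for A v
      unfolding \<sigma>2 using m card_cells_in_block[OF m, of A v] by (simp add: field_simps)
    show "A \<subseteq> ?E" if "A \<in> ?S" for A by (rule grid_staircases_subset[OF that])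
  qed (use E block m t l s in \<open>auto intro: indep_clocks_cell_increments distr_cell_increment
        finite_grid_staircases simp: grid_staircases_nonempty\<close>)
  also have "(\<integral>\<^sup>+\<omega>. ennreal (exp (s * l * (max_sum ?S (\<lambda>e. cell_increment m e (case_prod N (?block e) t \<omega>) \<omega>)
       - max_sum ?S (\<lambda>e. cell_increment m e 0 \<omega>)))) \<partial>M) =
     (\<integral>\<^sup>+\<omega>. ennreal (exp (s * l * (grid_time n m t \<omega> - grid_time n m 0 \<omega>))) \<partial>M)"
  proof (rule nn_integral_cong)
    fix \<omega> assume "\<omega> \<in> space M"
    then have "N i j 0 \<omega> = 0" for i j using clock by (auto simp: poisson_clock_def)
    then show "ennreal (exp (s * l * (max_sum ?S (\<lambda>e. cell_increment m e (case_prod N (?block e) t \<omega>) \<omega>)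
       - max_sum ?S (\<lambda>e. cell_increment m e 0 \<omega>)))) = ennreal (exp (s * l * (grid_time n m t \<omega> - grid_time n m 0 \<omega>)))"
      by (simp add: grid_time_def)
  qed
  finally show ?thesis .
qed

lemma passage_time_measurable:
  "dynamical_passage_time N B (0, 0) (real n, int n) t \<in> borel_measurable M"
proof (rule borel_measurable_LIMSEQ_real)
  show "(\<lambda>m. grid_time n (Suc m) t \<omega>) \<longlonglongrightarrow> dynamical_passage_time N B (0, 0) (real n, int n) t \<omega>"
    if "\<omega> \<in> space M" for \<omega>
    using grid_time_tendsto[OF that] by (rule LIMSEQ_Suc)
  show "grid_time n (Suc m) t \<in> borel_measurable M" for m
    by (rule grid_time_measurable) simp
qed

text \<open>Fatou's lemma, as the bound for the grid does not depend on the mesh.\<close>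

lemma exp_passage_time_difference:
  assumes n: "n \<ge> 1" and t: "t \<ge> 0" and l: "l \<ge> 0" "2 * l\<^sup>2 \<le> 1" and s: "s = 1 \<or> s = -1"
  shows "(\<integral>\<^sup>+\<omega>. ennreal (exp (s * l * (dynamical_passage_time N B (0, 0) (real n, int n) t \<omega>
      - dynamical_passage_time N B (0, 0) (real n, int n) 0 \<omega>))) \<partial>M) \<le> ennreal (exp (4 * l\<^sup>2 * t * real n))"
    (is "(\<integral>\<^sup>+\<omega>. ?u \<omega> \<partial>M) \<le> _")
proof -
  let ?um = "\<lambda>m \<omega>. ennreal (exp (s * l * (grid_time n (Suc m) t \<omega> - grid_time n (Suc m) 0 \<omega>)))"
  note [measurable] = grid_time_measurable[OF zero_less_Suc]
  have "(\<integral>\<^sup>+\<omega>. ?u \<omega> \<partial>M) = (\<integral>\<^sup>+\<omega>. liminf (\<lambda>m. ?um m \<omega>) \<partial>M)"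
  proof (rule nn_integral_cong)
    fix \<omega> assume \<omega>: "\<omega> \<in> space M"
    have "(\<lambda>m. ?um m \<omega>) \<longlonglongrightarrow> ?u \<omega>"
      by (intro tendsto_ennrealI tendsto_intros LIMSEQ_Suc grid_time_tendsto \<omega>)
    then show "?u \<omega> = liminf (\<lambda>m. ?um m \<omega>)"
      by (rule lim_imp_Liminf[OF sequentially_bot, symmetric])
  qed
  also have "\<dots> \<le> liminf (\<lambda>m. \<integral>\<^sup>+\<omega>. ?um m \<omega> \<partial>M)"
    by (rule nn_integral_liminf) measurable
  also have "\<dots> \<le> liminf (\<lambda>m. ennreal (exp (4 * l\<^sup>2 * t * real n)))"
    by (intro Liminf_mono always_eventually allI exp_grid_time_difference assms) simp
  also have "\<dots> = ennreal (exp (4 * l\<^sup>2 * t * real n))"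
    by (simp add: Liminf_const)
  finally show ?thesis .
qed

lemma passage_time_difference_tail:
  assumes n: "n \<ge> 1" and t: "t \<ge> 0" and l: "l \<ge> 0" "2 * l\<^sup>2 \<le> 1" and s: "s = 1 \<or> s = -1"
  shows "\<P>(\<omega> in M. s * (dynamical_passage_time N B (0, 0) (real n, int n) t \<omega>
      - dynamical_passage_time N B (0, 0) (real n, int n) 0 \<omega>) > x) \<le> exp (4 * l\<^sup>2 * t * real n - l * x)"
proof -
  note [measurable] = passage_time_measurable
  let ?D = "\<lambda>\<omega>. dynamical_passage_time N B (0, 0) (real n, int n) t \<omega>
      - dynamical_passage_time N B (0, 0) (real n, int n) 0 \<omega>"
  let ?A = "{\<omega> \<in> space M. s * ?D \<omega> > x}"
  have "ennreal (exp (l * x)) * emeasure M ?A = (\<integral>\<^sup>+\<omega>. ennreal (exp (l * x)) * indicator ?A \<omega> \<partial>M)"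
    by (subst nn_integral_cmult_indicator) auto
  also have "\<dots> \<le> (\<integral>\<^sup>+\<omega>. ennreal (exp (s * l * ?D \<omega>)) \<partial>M)"
  proof (rule nn_integral_mono)
    fix \<omega>
    have "exp (l * x) \<le> exp (s * l * ?D \<omega>)" if "x < s * ?D \<omega>"
      using mult_left_mono[of x "s * ?D \<omega>" l] l that by (simp add: mult_ac)
    then show "ennreal (exp (l * x)) * indicator ?A \<omega> \<le> ennreal (exp (s * l * ?D \<omega>))"
      by (auto simp: indicator_def intro: ennreal_leI)
  qed
  also have "\<dots> \<le> ennreal (exp (4 * l\<^sup>2 * t * real n))"
    by (rule exp_passage_time_difference[OF assms])
  finally have "exp (l * x) * prob ?A \<le> exp (4 * l\<^sup>2 * t * real n)"
    by (simp add: emeasure_eq_measure flip: ennreal_mult')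
  then show ?thesis by (simp add: exp_diff field_simps)
qed

end

theorem theorem4:
  shows "\<exists>C::real. \<forall>(M :: 'a measure) N B. dynamical_blpp M N B \<longrightarrow>
    (\<forall>(n::nat) (t::real) (u::real). n \<ge> 1 \<and> t \<ge> 0 \<and> u \<ge> 2 \<longrightarrow>
      measure M {\<omega> \<in> space M.
        \<bar>dynamical_passage_time N B (0, 0) (real n, int n) t \<omega>
          - dynamical_passage_time N B (0, 0) (real n, int n) 0 \<omega>\<bar>
        > C * (sqrt (real n * t * u) + u)}
      \<le> 2 * exp (- u))"
proof (intro exI[of _ 4] allI impI, elim conjE)
  fix M :: "'a measure" and N B and n :: nat and t u :: real
  assume "dynamical_blpp M N B" and n: "n \<ge> 1" and t: "t \<ge> 0" and u: "u \<ge> 2"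
  interpret dynamical_blpp M N B by fact
  let ?D = "\<lambda>\<omega>. dynamical_passage_time N B (0, 0) (real n, int n) t \<omega>
          - dynamical_passage_time N B (0, 0) (real n, int n) 0 \<omega>"
  let ?x = "4 * (sqrt (real n * t * u) + u)"
  note [measurable] = passage_time_measurable
  \<comment> \<open>The unconstrained minimiser of \<open>4 l\<^sup>2 n t - l x\<close> has order \<open>sqrt (u / (n t))\<close>; it has to be cut off
    at a constant because of \<open>2 l\<^sup>2 \<le> 1\<close>, which produces the linear term in \<open>u\<close>.\<close>
  obtain l where l: "l \<ge> 0" "2 * l\<^sup>2 \<le> 1" and opt: "4 * l\<^sup>2 * t * real n - l * ?x \<le> - u"
  proof (cases "u \<le> real n * t")
    case True
    define l where "l = sqrt (u / (real n * t)) / 2"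
    have nt: "real n * t > 0" using True u by linarith
    then have nt0: "t \<noteq> 0" "n \<noteq> 0" using n by auto
    have l2: "l\<^sup>2 = u / (real n * t) / 4" using nt u by (simp add: l_def power_divide)
    have "2 * l\<^sup>2 = (u / (real n * t)) / 2" using l2 by simp
    also have "\<dots> \<le> 1 / 2" by (rule divide_right_mono) (use True nt in simp_all)
    finally have "2 * l\<^sup>2 \<le> 1" by simp
    moreover have "4 * l\<^sup>2 * t * real n = u" unfolding l2 using nt0 by simp
    moreover have "l * sqrt (real n * t * u) = u / 2"
    proof -
      have "sqrt (u / (real n * t)) * sqrt (real n * t * u) = sqrt (u\<^sup>2)"
        using nt0 by (simp flip: real_sqrt_mult add: power2_eq_square)
      then show ?thesis using u by (simp add: l_def)
    qed
    moreover have "l \<ge> 0" using u nt by (simp add: l_def)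
    moreover from this have "l * u \<ge> 0" using u by simp
    ultimately show ?thesis by (intro that[of l]) (auto simp: algebra_simps)
  next
    case False
    have "sqrt (real n * t * u) \<ge> 0" using t u by simp
    moreover have eq: "4 * (1 / 2)\<^sup>2 * t * real n - 1 / 2 * ?x = real n * t - 2 * sqrt (real n * t * u) - 2 * u"
      by (simp add: power2_eq_square add_divide_distrib)
    ultimately have "4 * (1 / 2)\<^sup>2 * t * real n - 1 / 2 * ?x \<le> - u"
      unfolding eq using False u by linarith
    then show ?thesis by (intro that[of "1 / 2"]) (simp_all add: power2_eq_square)
  qed
  have tail: "prob {\<omega> \<in> space M. s * ?D \<omega> > ?x} \<le> exp (- u)" if "s = 1 \<or> s = -1" for s
    by (rule order_trans[OF passage_time_difference_tail[OF n t l that] iffD2[OF exp_le_cancel_iff opt]])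
  let ?U = "{\<omega> \<in> space M. 1 * ?D \<omega> > ?x}" and ?L = "{\<omega> \<in> space M. -1 * ?D \<omega> > ?x}"
  have split: "{\<omega> \<in> space M. \<bar>?D \<omega>\<bar> > ?x} = ?U \<union> ?L"
    by auto
  have "prob (?U \<union> ?L) \<le> prob ?U + prob ?L"
    by (rule measure_Un_le) measurable
  then have "prob (?U \<union> ?L) \<le> exp (- u) + exp (- u)"
    by (rule order_trans) (rule add_mono[OF tail[OF disjI1[OF refl]] tail[OF disjI2[OF refl]]])
  then show "prob {\<omega> \<in> space M. \<bar>?D \<omega>\<bar> > ?x} \<le> 2 * exp (- u)"
    unfolding split by simp
qed

end
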